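(* Let $\mathcal{C}$ be a small category. Then the conditions (SUR1), (SUR2) and (SUR3) on $\mathcal{C}$ are all equivalent to stable universal rigidity. That is, the following four conditions are equivalent: (a) $\mathcal{C}$ is stably universally rigid; (b) $\mathcal{C}$ satisfies (SUR1); (c) $\mathcal{C}$ satisfies (SUR2); (d) $\mathcal{C}$ satisfies (SUR3).
   Context: Composition is written in diagrammatic order: for $f:X\to Y$ and $g:Y\to Z$, the composite is $fg:X\to Z$. A category is Cauchy-complete if every idempotent splits. $\mathcal{C}_{/X}$ denotes the slice category over $X$. Rigidity. Let $J$ be a Grothendieck topology on a small category $\mathcal{C}$. $J$ is rigid if the corresponding subtopos of $[\mathcal{C}^{\mathrm{op}},\mathrm{Set}]$ is the one given by $[\mathcal{D}^{\mathrm{op}},\mathrm{Set}]$ for some full subcategory $\mathcal{D}\subseteq\mathcal{C}$. Equivalently: call an object $X$ $J$-irreducible if the only $J$-covering sieve on $X$ is the maximal sieve; then $J$ is rigid if and only if every object of $\mathcal{C}$ admits a $J$-covering by $J$-irreducible objects. $\mathcal{C}$ is universally rigid if every Grothendieck topology on $\mathcal{C}$ is rigid. $\mathcal{C}$ is stably universally rigid if $\mathcal{C}_{/X}$ is universally rigid for every object $X$ of $\mathcal{C}$. Images and poset reflections. For $f:Y\to X$ in $\mathcal{C}$, $\mathrm{im}(f)$ is the image of the corresponding morphism of representable presheaves in $[\mathcal{C}^{\mathrm{op}},\mathrm{Set}]$, a subobject of (the presheaf represented by) $X$; equivalently it is the sieve of all morphisms into $X$ that factor through $f$. We write $\mathrm{im}(f)=X$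 when this is all of the representable $X$, i.e. when $f$ is a split epimorphism. The poset reflection of a small category is obtained by setting $A\le B$ when there exists a morphism $A\to B$ and quotienting by the induced equivalence relation. A poset is Artinian if it has no infinite strictly decreasing sequence of elements. Condition (SUR1): (i) for each object $X$ of $\mathcal{C}$, the poset reflection of $\mathcal{C}_{/X}$ is Artinian; and (ii) for each $f:Y\to X$ in $\mathcal{C}$ there is $f':Y'\to X$ with $\mathrm{im}(f)=\mathrm{im}(f')$ and such that for every $r:Z\to Y'$, if $\mathrm{im}(f')=\mathrm{im}(rf')$ then $\mathrm{im}(r)=Y'$. Condition (SUR2): Cleaner has a winning strategy in the game of split epi on $\mathcal{C}$. This game is played by two players, Cleaner and Reducer, who alternate moves. The state of the game is a morphism $f$ of $\mathcal{C}$, whose codomain never changes. A move by Cleaner in position $f$ consists in choosing a factorization $f=rf'$ where $r$ is a split epimorphism (possibly an identity); the new position is $f'$. A move by Reducer in position $f$ consists in choosing a morphism $r$ that is not a split epimorphism, with codomain the domain of $f$; the new position is $rf$. Cleaner wins if Reducer cannot make a valid move; Reducer wins if the game continues forever. Having a winning strategy for Cleaner means having one from every initial position (it does not matter which player moves first). Condition (SUR3): (i) $\mathcal{C}$ is Cauchy-complete; (ii) for each object $X$ of $\mathcal{C}$, the poset reflection of $\mathcal{C}_{/X}$ is Artinian; (iii) for each object $X$ of $\mathcal{C}$, the monoid $\mathrm{End}(X)$ (with product $fg$ = first $f$, then $g$) has enough idempotents on the left. Here a monoid $M$ has enough idempotents on the left if for every $f\in M$, either $f$ has a left inverse (some $g$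 with $gf=1$) or there are a non-identity idempotent $e\in M$ and some $n\ge 1$ with $ef^n=f^n$. *)

theory Defs
  imports "HOL-Algebra.Group"
begin

section \<open>Small categories\<close>

text \<open>Composition is diagrammatic: \<open>f \<Zsemi>\<^bsub>C\<^esub> g\<close> is first \<open>f\<close>, then \<open>g\<close>. Outside
  composable pairs of arrows its value is irrelevant.\<close>

record ('o, 'a) cat =
  Ob :: "'o set"
  Ar :: "'a set"
  Dom :: "'a \<Rightarrow> 'o"
  Cod :: "'a \<Rightarrow> 'o"
  Idt :: "'o \<Rightarrow> 'a"
  Comp :: "'a \<Rightarrow> 'a \<Rightarrow> 'a" (infixl "\<Zsemi>\<index>" 70)

locale category =
  fixes C :: "('o, 'a) cat" (structure)
  assumes Dom_in: "f \<in> Ar C \<Longrightarrow> Dom C f \<in> Ob C"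
    and Cod_in: "f \<in> Ar C \<Longrightarrow> Cod C f \<in> Ob C"
    and Idt_in: "X \<in> Ob C \<Longrightarrow> Idt C X \<in> Ar C"
    and Dom_Idt: "X \<in> Ob C \<Longrightarrow> Dom C (Idt C X) = X"
    and Cod_Idt: "X \<in> Ob C \<Longrightarrow> Cod C (Idt C X) = X"
    and Comp_in: "\<lbrakk>f \<in> Ar C; g \<in> Ar C; Cod C f = Dom C g\<rbrakk> \<Longrightarrow> f \<Zsemi> g \<in> Ar C"
    and Dom_Comp: "\<lbrakk>f \<in> Ar C; g \<in> Ar C; Cod C f = Dom C g\<rbrakk> \<Longrightarrow> Dom C (f \<Zsemi> g) = Dom C f"
    and Cod_Comp: "\<lbrakk>f \<in> Ar C; g \<in> Ar C; Cod C f = Dom C g\<rbrakk> \<Longrightarrow> Cod C (f \<Zsemi> g) = Cod C g"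
    and Idt_Comp: "f \<in> Ar C \<Longrightarrow> Idt C (Dom C f) \<Zsemi> f = f"
    and Comp_Idt: "f \<in> Ar C \<Longrightarrow> f \<Zsemi> Idt C (Cod C f) = f"
    and Comp_assoc: "\<lbrakk>f \<in> Ar C; g \<in> Ar C; h \<in> Ar C; Cod C f = Dom C g; Cod C g = Dom C h\<rbrakk>
        \<Longrightarrow> (f \<Zsemi> g) \<Zsemi> h = f \<Zsemi> (g \<Zsemi> h)"

text \<open>An arrow of the slice over \<open>X\<close> is a pair \<open>(h, g)\<close> of arrows with \<open>g\<close> into \<open>X\<close> and
  \<open>h\<close> into the domain of \<open>g\<close>; it is the morphism from \<open>h \<Zsemi> g\<close> to \<open>g\<close> given by \<open>h\<close>.\<close>

definition slice :: "('o, 'a) cat \<Rightarrow> 'o \<Rightarrow> ('a, 'a \<times> 'a) cat" where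
  "slice C X = \<lparr>
     Ob = {f \<in> Ar C. Cod C f = X},
     Ar = {(h, g). h \<in> Ar C \<and> g \<in> Ar C \<and> Cod C h = Dom C g \<and> Cod C g = X},
     Dom = (\<lambda>(h, g). h \<Zsemi>\<^bsub>C\<^esub> g),
     Cod = (\<lambda>(h, g). g),
     Idt = (\<lambda>g. (Idt C (Dom C g), g)),
     Comp = (\<lambda>(h, g) (h', g'). (h \<Zsemi>\<^bsub>C\<^esub> h', g')) \<rparr>"

definition split_epi :: "('o, 'a) cat \<Rightarrow> 'a \<Rightarrow> bool" where
  "split_epi C f \<longleftrightarrow> f \<in> Ar C \<and>
     (\<exists>s\<in>Ar C. Dom C s = Cod C f \<and> Cod C s = Dom C f \<and> s \<Zsemi>\<^bsub>C\<^esub> f = Idt C (Cod C f))"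

definition cauchy_complete :: "('o, 'a) cat \<Rightarrow> bool" where
  "cauchy_complete C \<longleftrightarrow>
     (\<forall>e\<in>Ar C. Dom C e = Cod C e \<and> e \<Zsemi>\<^bsub>C\<^esub> e = e \<longrightarrow>
        (\<exists>r\<in>Ar C. \<exists>s\<in>Ar C. Dom C r = Dom C e \<and> Cod C r = Dom C s \<and> Cod C s = Dom C e \<and>
           r \<Zsemi>\<^bsub>C\<^esub> s = e \<and> s \<Zsemi>\<^bsub>C\<^esub> r = Idt C (Cod C r)))"


section \<open>Grothendieck topologies, presheaves and rigidity\<close>

definition max_sieve :: "('o, 'a) cat \<Rightarrow> 'o \<Rightarrow> 'a set" where
  "max_sieve C X = {f \<in> Ar C. Cod C f = X}"

definition sieve :: "('o, 'a) cat \<Rightarrow> 'o \<Rightarrow> 'a set \<Rightarrow> bool" where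
  "sieve C X S \<longleftrightarrow> S \<subseteq> max_sieve C X \<and>
     (\<forall>f\<in>S. \<forall>g\<in>Ar C. Cod C g = Dom C f \<longrightarrow> g \<Zsemi>\<^bsub>C\<^esub> f \<in> S)"

definition pull_sieve :: "('o, 'a) cat \<Rightarrow> 'a \<Rightarrow> 'a set \<Rightarrow> 'a set" where
  "pull_sieve C f S = {g \<in> Ar C. Cod C g = Dom C f \<and> g \<Zsemi>\<^bsub>C\<^esub> f \<in> S}"

definition grothendieck_topology :: "('o, 'a) cat \<Rightarrow> ('o \<Rightarrow> 'a set set) \<Rightarrow> bool" where
  "grothendieck_topology C J \<longleftrightarrow>
     (\<forall>X\<in>Ob C. \<forall>S\<in>J X. sieve C X S) \<and>
     (\<forall>X\<in>Ob C. max_sieve C X \<in> J X) \<and>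
     (\<forall>f\<in>Ar C. \<forall>S\<in>J (Cod C f). pull_sieve C f S \<in> J (Dom C f)) \<and>
     (\<forall>X\<in>Ob C. \<forall>S\<in>J X. \<forall>R. sieve C X R \<and> (\<forall>f\<in>S. pull_sieve C f R \<in> J (Dom C f)) \<longrightarrow> R \<in> J X)"

record ('o, 'a, 'v) presheaf =
  Val :: "'o \<Rightarrow> 'v set"
  Res :: "'a \<Rightarrow> 'v \<Rightarrow> 'v"

definition is_presheaf :: "('o, 'a) cat \<Rightarrow> ('o, 'a, 'v) presheaf \<Rightarrow> bool" where
  "is_presheaf C P \<longleftrightarrow>
     (\<forall>f\<in>Ar C. \<forall>x\<in>Val P (Cod C f). Res P f x \<in> Val P (Dom C f)) \<and>
     (\<forall>X\<in>Ob C. \<forall>x\<in>Val P X. Res P (Idt C X) x = x) \<and>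
     (\<forall>g\<in>Ar C. \<forall>f\<in>Ar C. Cod C g = Dom C f \<longrightarrow>
        (\<forall>x\<in>Val P (Cod C f). Res P (g \<Zsemi>\<^bsub>C\<^esub> f) x = Res P g (Res P f x)))"

definition is_sheaf ::
    "('o, 'a) cat \<Rightarrow> ('o \<Rightarrow> 'a set set) \<Rightarrow> ('o, 'a, 'v) presheaf \<Rightarrow> bool" where
  "is_sheaf C J P \<longleftrightarrow> is_presheaf C P \<and>
     (\<forall>X\<in>Ob C. \<forall>S\<in>J X. \<forall>x.
        (\<forall>f\<in>S. x f \<in> Val P (Dom C f)) \<and>
        (\<forall>f\<in>S. \<forall>g\<in>Ar C. Cod C g = Dom C f \<longrightarrow> x (g \<Zsemi>\<^bsub>C\<^esub> f) = Res P g (x f)) \<longrightarrow>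
        (\<exists>!s. s \<in> Val P X \<and> (\<forall>f\<in>S. Res P f s = x f)))"

text \<open>For a full subcategory on a set \<open>D\<close> of objects, the presheaf topos on \<open>D\<close> is the subtopos
  of the presheaves on \<open>C\<close> that are right Kan extensions along the inclusion of \<open>D\<close>: the
  canonical map from \<open>P X\<close> to the set of natural transformations \<open>C(-, X) \<rightarrow> P\<close> of presheaves
  on \<open>D\<close> is bijective for every \<open>X\<close>.\<close>

definition extended_from ::
    "('o, 'a) cat \<Rightarrow> 'o set \<Rightarrow> ('o, 'a, 'v) presheaf \<Rightarrow> bool" where
  "extended_from C D P \<longleftrightarrow> is_presheaf C P \<and>
     (\<forall>X\<in>Ob C. \<forall>x.
        (\<forall>f\<in>max_sieve C X. Dom C f \<in> D \<longrightarrow> x f \<in> Val P (Dom C f)) \<and>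
        (\<forall>f\<in>max_sieve C X. \<forall>g\<in>Ar C. Dom C f \<in> D \<and> Dom C g \<in> D \<and> Cod C g = Dom C f \<longrightarrow>
            x (g \<Zsemi>\<^bsub>C\<^esub> f) = Res P g (x f)) \<longrightarrow>
        (\<exists>!s. s \<in> Val P X \<and> (\<forall>f\<in>max_sieve C X. Dom C f \<in> D \<longrightarrow> Res P f s = x f)))"

text \<open>The topology \<open>J\<close> is rigid if the subtopos of \<open>J\<close>-sheaves is the one of presheaves on some
  full subcategory. The presheaves range over those whose values are
  collections of sets of arrows. This loses nothing: the presheaf of \<open>J\<close>-closed sieves is of this
  kind, and such presheaves already distinguish any two Grothendieck topologies. The equivalent
  form in terms of irreducible objects is \<open>rigid_iff_irreducible\<close> below.\<close>

definition rigid :: "('o, 'a) cat \<Rightarrow> ('o \<Rightarrow> 'a set set) \<Rightarrow> bool" where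
  "rigid C J \<longleftrightarrow> (\<exists>D\<subseteq>Ob C. \<forall>P :: ('o, 'a, 'a set) presheaf.
     is_sheaf C J P \<longleftrightarrow> extended_from C D P)"

definition universally_rigid :: "('o, 'a) cat \<Rightarrow> bool" where
  "universally_rigid C \<longleftrightarrow> (\<forall>J. grothendieck_topology C J \<longrightarrow> rigid C J)"

definition stably_universally_rigid :: "('o, 'a) cat \<Rightarrow> bool" where
  "stably_universally_rigid C \<longleftrightarrow> (\<forall>X\<in>Ob C. universally_rigid (slice C X))"


section \<open>Poset reflection and the Artinian condition\<close>

definition hom_preorder :: "('o, 'a) cat \<Rightarrow> 'o rel" where
  "hom_preorder C = {(A, B). A \<in> Ob C \<and> B \<in> Ob C \<and> (\<exists>f\<in>Ar C. Dom C f = A \<and> Cod C f = B)}"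

definition poset_reflection :: "('o, 'a) cat \<Rightarrow> 'o set set" where
  "poset_reflection C = Ob C // (hom_preorder C \<inter> (hom_preorder C)\<inverse>)"

definition poset_reflection_le :: "('o, 'a) cat \<Rightarrow> 'o set rel" where
  "poset_reflection_le C = {(p, q). p \<in> poset_reflection C \<and> q \<in> poset_reflection C \<and>
     (\<exists>A\<in>p. \<exists>B\<in>q. (A, B) \<in> hom_preorder C)}"

definition artinian :: "'p set \<Rightarrow> 'p rel \<Rightarrow> bool" where
  "artinian P R \<longleftrightarrow> \<not> (\<exists>s :: nat \<Rightarrow> 'p. (\<forall>n. s n \<in> P) \<and>
     (\<forall>n. (s (Suc n), s n) \<in> R \<and> s (Suc n) \<noteq> s n))"

definition slices_artinian :: "('o, 'a) cat \<Rightarrow> bool" where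
  "slices_artinian C \<longleftrightarrow> (\<forall>X\<in>Ob C.
     artinian (poset_reflection (slice C X)) (poset_reflection_le (slice C X)))"


section \<open>The three conditions\<close>

definition im :: "('o, 'a) cat \<Rightarrow> 'a \<Rightarrow> 'a set" where
  "im C f = {h \<Zsemi>\<^bsub>C\<^esub> f |h. h \<in> Ar C \<and> Cod C h = Dom C f}"

definition SUR1 :: "('o, 'a) cat \<Rightarrow> bool" where
  "SUR1 C \<longleftrightarrow> slices_artinian C \<and>
     (\<forall>f\<in>Ar C. \<exists>f'\<in>Ar C. Cod C f' = Cod C f \<and> im C f = im C f' \<and>
        (\<forall>r\<in>Ar C. Cod C r = Dom C f' \<and> im C f' = im C (r \<Zsemi>\<^bsub>C\<^esub> f') \<longrightarrow>
           im C r = max_sieve C (Dom C f')))"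

definition cleaner_move :: "('o, 'a) cat \<Rightarrow> 'a \<Rightarrow> 'a \<Rightarrow> bool" where
  "cleaner_move C f f' \<longleftrightarrow> f' \<in> Ar C \<and>
     (\<exists>r. split_epi C r \<and> Cod C r = Dom C f' \<and> f = r \<Zsemi>\<^bsub>C\<^esub> f')"

definition reducer_move :: "('o, 'a) cat \<Rightarrow> 'a \<Rightarrow> 'a \<Rightarrow> bool" where
  "reducer_move C f f' \<longleftrightarrow>
     (\<exists>r\<in>Ar C. \<not> split_epi C r \<and> Cod C r = Dom C f \<and> f' = r \<Zsemi>\<^bsub>C\<^esub> f)"

text \<open>A strategy for Cleaner assigns a new position to every nonempty history, i.e. the list of all
  positions so far, the current one last. Legal moves for Cleaner always exist, because identities
  are split epimorphisms, so legality can be required on all histories.\<close>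

definition cleaner_strategy :: "('o, 'a) cat \<Rightarrow> ('a list \<Rightarrow> 'a) \<Rightarrow> bool" where
  "cleaner_strategy C \<sigma> \<longleftrightarrow>
     (\<forall>h. h \<noteq> [] \<and> set h \<subseteq> Ar C \<longrightarrow> cleaner_move C (last h) (\<sigma> h))"

text \<open>An infinite play from \<open>f\<close> in which Cleaner follows \<open>\<sigma>\<close>. The flag \<open>c\<close> says that Cleaner
  moves first, in which case Cleaner moves in the positions with even index.\<close>

definition infinite_play ::
    "('o, 'a) cat \<Rightarrow> ('a list \<Rightarrow> 'a) \<Rightarrow> bool \<Rightarrow> 'a \<Rightarrow> (nat \<Rightarrow> 'a) \<Rightarrow> bool" where
  "infinite_play C \<sigma> c f p \<longleftrightarrow> p 0 = f \<and>
     (\<forall>n. if even n \<longleftrightarrow> c then p (Suc n) = \<sigma> (map p [0..<Suc n])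
          else reducer_move C (p n) (p (Suc n)))"

definition SUR2 :: "('o, 'a) cat \<Rightarrow> bool" where
  "SUR2 C \<longleftrightarrow> (\<forall>f\<in>Ar C. \<forall>c. \<exists>\<sigma>. cleaner_strategy C \<sigma> \<and> \<not> (\<exists>p. infinite_play C \<sigma> c f p))"

definition End_monoid :: "('o, 'a) cat \<Rightarrow> 'o \<Rightarrow> 'a monoid" where
  "End_monoid C X = \<lparr>carrier = {f \<in> Ar C. Dom C f = X \<and> Cod C f = X},
     monoid.mult = Comp C, one = Idt C X\<rparr>"

definition enough_idempotents_left :: "'m monoid \<Rightarrow> bool" where
  "enough_idempotents_left M \<longleftrightarrow> (\<forall>f\<in>carrier M.
     (\<exists>g\<in>carrier M. g \<otimes>\<^bsub>M\<^esub> f = \<one>\<^bsub>M\<^esub>) \<or>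
     (\<exists>e\<in>carrier M. e \<noteq> \<one>\<^bsub>M\<^esub> \<and> e \<otimes>\<^bsub>M\<^esub> e = e \<and>
        (\<exists>n::nat. n \<ge> 1 \<and> e \<otimes>\<^bsub>M\<^esub> (f [^]\<^bsub>M\<^esub> n) = f [^]\<^bsub>M\<^esub> n)))"

definition SUR3 :: "('o, 'a) cat \<Rightarrow> bool" where
  "SUR3 C \<longleftrightarrow> cauchy_complete C \<and> slices_artinian C \<and>
     (\<forall>X\<in>Ob C. enough_idempotents_left (End_monoid C X))"


section \<open>Consistency of the definitions\<close>

text \<open>Slices are categories, and rigidity amounts to every object being covered by irreducible
  ones.\<close>

lemma (in category) category_slice:
  assumes "X \<in> Ob C" shows "category (slice C X)"
proof
  let ?S = "slice C X"
  fix f g h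
  show "Dom ?S f \<in> Ob ?S" "Cod ?S f \<in> Ob ?S" if "f \<in> Ar ?S"
    using that by (cases f; simp add: slice_def Comp_in Cod_Comp)+
  show "Idt ?S g \<in> Ar ?S" "Dom ?S (Idt ?S g) = g" "Cod ?S (Idt ?S g) = g" if "g \<in> Ob ?S" for g
    using that by (simp_all add: slice_def Idt_in Dom_in Cod_Idt Idt_Comp)
  show "f \<Zsemi>\<^bsub>?S\<^esub> g \<in> Ar ?S" "Dom ?S (f \<Zsemi>\<^bsub>?S\<^esub> g) = Dom ?S f" "Cod ?S (f \<Zsemi>\<^bsub>?S\<^esub> g) = Cod ?S g"
    if "f \<in> Ar ?S" "g \<in> Ar ?S" "Cod ?S f = Dom ?S g"
    using that by (cases f; cases g; simp add: slice_def Comp_in Cod_Comp Dom_Comp Comp_assoc)+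
  show "Idt ?S (Dom ?S f) \<Zsemi>\<^bsub>?S\<^esub> f = f" if "f \<in> Ar ?S"
    using that by (cases f) (simp add: slice_def Dom_Comp Idt_Comp)
  show "f \<Zsemi>\<^bsub>?S\<^esub> Idt ?S (Cod ?S f) = f" if "f \<in> Ar ?S"
  proof (cases f)
    case (Pair h g)
    then show ?thesis using that Comp_Idt[of h] by (simp add: slice_def)
  qed
  show "(f \<Zsemi>\<^bsub>?S\<^esub> g) \<Zsemi>\<^bsub>?S\<^esub> h = f \<Zsemi>\<^bsub>?S\<^esub> (g \<Zsemi>\<^bsub>?S\<^esub> h)"
    if "f \<in> Ar ?S" "g \<in> Ar ?S" "h \<in> Ar ?S" "Cod ?S f = Dom ?S g" "Cod ?S g = Dom ?S h"
    using that by (cases f; cases g; cases h) (simp add: slice_def Dom_Comp Comp_assoc)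
qed

definition irreducible_obj :: "('o, 'a) cat \<Rightarrow> ('o \<Rightarrow> 'a set set) \<Rightarrow> 'o \<Rightarrow> bool" where
  "irreducible_obj C J X \<longleftrightarrow> X \<in> Ob C \<and> (\<forall>S\<in>J X. S = max_sieve C X)"

definition generated_sieve :: "('o, 'a) cat \<Rightarrow> 'o set \<Rightarrow> 'o \<Rightarrow> 'a set" where
  "generated_sieve C D X = {h \<Zsemi>\<^bsub>C\<^esub> k |h k. h \<in> Ar C \<and> k \<in> Ar C \<and> Cod C h = Dom C k \<and>
     Cod C k = X \<and> Dom C k \<in> D}"

definition full_topology :: "('o, 'a) cat \<Rightarrow> 'o set \<Rightarrow> 'o \<Rightarrow> 'a set set" where
  "full_topology C D X = {S. sieve C X S \<and> (\<forall>f\<in>max_sieve C X. Dom C f \<in> D \<longrightarrow> f \<in> S)}"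

definition closed_sieve :: "('o, 'a) cat \<Rightarrow> ('o \<Rightarrow> 'a set set) \<Rightarrow> 'o \<Rightarrow> 'a set \<Rightarrow> bool" where
  "closed_sieve C J X S \<longleftrightarrow> sieve C X S \<and>
     (\<forall>f\<in>max_sieve C X. pull_sieve C f S \<in> J (Dom C f) \<longrightarrow> f \<in> S)"

definition closed_presheaf ::
    "('o, 'a) cat \<Rightarrow> ('o \<Rightarrow> 'a set set) \<Rightarrow> ('o, 'a, 'a set) presheaf" where
  "closed_presheaf C J = \<lparr>Val = (\<lambda>X. {S. closed_sieve C J X S}), Res = pull_sieve C\<rparr>"

definition sieve_closure :: "('o, 'a) cat \<Rightarrow> ('o \<Rightarrow> 'a set set) \<Rightarrow> 'o \<Rightarrow> 'a set \<Rightarrow> 'a set" where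
  "sieve_closure C J X S = {f \<in> max_sieve C X. pull_sieve C f S \<in> J (Dom C f)}"

context category
begin

lemma sieve_max: "sieve C X (max_sieve C X)"
  by (auto simp: sieve_def max_sieve_def Comp_in Cod_Comp)

lemma sieve_pull:
  assumes "sieve C (Cod C f) S" "f \<in> Ar C" shows "sieve C (Dom C f) (pull_sieve C f S)"
  using assms by (auto simp: sieve_def max_sieve_def pull_sieve_def Comp_in Cod_Comp Dom_Comp Comp_assoc)

lemma pull_pull:
  assumes "f \<in> Ar C" "g \<in> Ar C" "Cod C g = Dom C f"
  shows "pull_sieve C g (pull_sieve C f S) = pull_sieve C (g \<Zsemi> f) S"
  using assms by (auto simp: pull_sieve_def Comp_in Cod_Comp Dom_Comp Comp_assoc)

lemma pull_Idt:
  assumes "X \<in> Ob C" "sieve C X S" shows "pull_sieve C (Idt C X) S = S"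
proof -
  have "g \<in> pull_sieve C (Idt C X) S \<longleftrightarrow> g \<in> S" for g
  proof (cases "g \<in> Ar C \<and> Cod C g = X")
    case True
    then show ?thesis using Comp_Idt[of g] assms(1) by (simp add: pull_sieve_def Dom_Idt)
  next
    case False
    then show ?thesis using assms by (auto simp: pull_sieve_def sieve_def max_sieve_def Dom_Idt)
  qed
  then show ?thesis by blast
qed

lemma pull_eq_max:
  assumes "f \<in> S" "sieve C X S" shows "pull_sieve C f S = max_sieve C (Dom C f)"
  using assms by (auto simp: pull_sieve_def sieve_def max_sieve_def)

lemma mem_iff_Idt_pull:
  assumes "f \<in> Ar C" shows "Idt C (Dom C f) \<in> pull_sieve C f S \<longleftrightarrow> f \<in> S"
  using assms by (simp add: pull_sieve_def Idt_in Dom_in Cod_Idt Idt_Comp)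

lemma topology_sieve: "\<lbrakk>grothendieck_topology C J; X \<in> Ob C; S \<in> J X\<rbrakk> \<Longrightarrow> sieve C X S"
  by (auto simp: grothendieck_topology_def)

lemma topology_max: "\<lbrakk>grothendieck_topology C J; X \<in> Ob C\<rbrakk> \<Longrightarrow> max_sieve C X \<in> J X"
  by (auto simp: grothendieck_topology_def)

lemma topology_pull:
  "\<lbrakk>grothendieck_topology C J; f \<in> Ar C; S \<in> J (Cod C f)\<rbrakk> \<Longrightarrow> pull_sieve C f S \<in> J (Dom C f)"
  by (auto simp: grothendieck_topology_def)

lemma topology_trans:
  "\<lbrakk>grothendieck_topology C J; X \<in> Ob C; S \<in> J X; sieve C X R;
    \<And>f. f \<in> S \<Longrightarrow> pull_sieve C f R \<in> J (Dom C f)\<rbrakk> \<Longrightarrow> R \<in> J X"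
  unfolding grothendieck_topology_def by blast

lemma topology_mono:
  assumes J: "grothendieck_topology C J" and X: "X \<in> Ob C" and S: "S \<in> J X"
    and R: "sieve C X R" "S \<subseteq> R"
  shows "R \<in> J X"
proof (rule topology_trans[OF J X S R(1)])
  fix f assume f: "f \<in> S"
  then have "f \<in> Ar C" using topology_sieve[OF J X S] by (auto simp: sieve_def max_sieve_def)
  then show "pull_sieve C f R \<in> J (Dom C f)"
    using pull_eq_max[of f R X] R f topology_max[OF J, of "Dom C f"] by (auto simp: Dom_in)
qed

lemma full_topology: "grothendieck_topology C (full_topology C D)"
  unfolding grothendieck_topology_def
proof (intro conjI ballI allI impI)
  fix X S assume "S \<in> full_topology C D X"
  then show "sieve C X S" by (simp add: full_topology_def)
next
  fix X show "max_sieve C X \<in> full_topology C D X" by (simp add: full_topology_def sieve_max)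
next
  fix f S assume "f \<in> Ar C" "S \<in> full_topology C D (Cod C f)"
  then show "pull_sieve C f S \<in> full_topology C D (Dom C f)"
    by (auto simp: full_topology_def sieve_pull)
      (auto simp: max_sieve_def pull_sieve_def Comp_in Cod_Comp Dom_Comp)
next
  fix X S R assume S: "S \<in> full_topology C D X"
    and R: "sieve C X R \<and> (\<forall>f\<in>S. pull_sieve C f R \<in> full_topology C D (Dom C f))"
  have "f \<in> R" if f: "f \<in> max_sieve C X" "Dom C f \<in> D" for f
  proof -
    have "f \<in> Ar C" using f by (simp add: max_sieve_def)
    moreover have "f \<in> S" using S f by (auto simp: full_topology_def)
    then have "pull_sieve C f R \<in> full_topology C D (Dom C f)" using R by blast
    then have "Idt C (Dom C f) \<in> pull_sieve C f R"
      using \<open>f \<in> Ar C\<close> f by (auto simp: full_topology_def max_sieve_def Idt_in Dom_in Dom_Idt Cod_Idt)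
    ultimately show ?thesis by (simp add: mem_iff_Idt_pull)
  qed
  then show "R \<in> full_topology C D X" using R by (auto simp: full_topology_def)
qed

lemma sieve_generated: "sieve C X (generated_sieve C D X)"
  unfolding sieve_def
proof (intro conjI ballI impI)
  show "generated_sieve C D X \<subseteq> max_sieve C X"
    by (auto simp: generated_sieve_def max_sieve_def Comp_in Cod_Comp)
  fix f g assume "f \<in> generated_sieve C D X" and g: "g \<in> Ar C" "Cod C g = Dom C f"
  then obtain h k where hk: "f = h \<Zsemi> k" "h \<in> Ar C" "k \<in> Ar C" "Cod C h = Dom C k" "Cod C k = X" "Dom C k \<in> D"
    by (auto simp: generated_sieve_def)
  then have "g \<Zsemi> f = (g \<Zsemi> h) \<Zsemi> k" "g \<Zsemi> h \<in> Ar C" "Cod C (g \<Zsemi> h) = Dom C k"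
    using g by (auto simp: Comp_assoc Dom_Comp Comp_in Cod_Comp)
  then show "g \<Zsemi> f \<in> generated_sieve C D X" using hk unfolding generated_sieve_def by blast
qed

lemma generated_base:
  assumes "f \<in> max_sieve C X" "Dom C f \<in> D" shows "f \<in> generated_sieve C D X"
proof -
  have "f \<in> Ar C" "Cod C f = X" using assms by (auto simp: max_sieve_def)
  then have "f = Idt C (Dom C f) \<Zsemi> f" "Idt C (Dom C f) \<in> Ar C" "Cod C (Idt C (Dom C f)) = Dom C f"
    by (simp_all add: Idt_Comp Idt_in Cod_Idt Dom_in)
  then show ?thesis using assms \<open>f \<in> Ar C\<close> \<open>Cod C f = X\<close> unfolding generated_sieve_def by blast
qed

lemma generated_full: "generated_sieve C D X \<in> full_topology C D X"
  by (simp add: full_topology_def sieve_generated generated_base)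

lemma presheafD:
  assumes "is_presheaf C P"
  shows "\<lbrakk>f \<in> Ar C; x \<in> Val P (Cod C f)\<rbrakk> \<Longrightarrow> Res P f x \<in> Val P (Dom C f)"
    and "\<lbrakk>X \<in> Ob C; x \<in> Val P X\<rbrakk> \<Longrightarrow> Res P (Idt C X) x = x"
    and "\<lbrakk>g \<in> Ar C; f \<in> Ar C; Cod C g = Dom C f; x \<in> Val P (Cod C f)\<rbrakk>
      \<Longrightarrow> Res P (g \<Zsemi> f) x = Res P g (Res P f x)"
  using assms by (auto simp: is_presheaf_def)

lemma sheaf_ex1:
  assumes "is_sheaf C J P" "X \<in> Ob C" "S \<in> J X" "\<forall>f\<in>S. x f \<in> Val P (Dom C f)"
    "\<forall>f\<in>S. \<forall>g\<in>Ar C. Cod C g = Dom C f \<longrightarrow> x (g \<Zsemi> f) = Res P g (x f)"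
  shows "\<exists>!s. s \<in> Val P X \<and> (\<forall>f\<in>S. Res P f s = x f)"
  using assms unfolding is_sheaf_def by blast

lemma extended_imp_sheaf:
  assumes ext: "extended_from C D P" shows "is_sheaf C (full_topology C D) P"
  unfolding is_sheaf_def
proof (intro conjI ballI allI impI)
  show P: "is_presheaf C P" using ext by (simp add: extended_from_def)
  fix X S x
  assume X: "X \<in> Ob C" and S: "S \<in> full_topology C D X"
    and x: "(\<forall>f\<in>S. x f \<in> Val P (Dom C f)) \<and>
      (\<forall>f\<in>S. \<forall>g\<in>Ar C. Cod C g = Dom C f \<longrightarrow> x (g \<Zsemi> f) = Res P g (x f))"
  have S': "sieve C X S" "\<And>f. f \<in> max_sieve C X \<Longrightarrow> Dom C f \<in> D \<Longrightarrow> f \<in> S"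
    using S by (auto simp: full_topology_def)
  have Sar: "f \<in> Ar C \<and> Cod C f = X" if "f \<in> S" for f
    using that S' by (auto simp: sieve_def max_sieve_def)
  have exu: "\<exists>!s. s \<in> Val P Y \<and> (\<forall>f\<in>max_sieve C Y. Dom C f \<in> D \<longrightarrow> Res P f s = y f)"
    if "Y \<in> Ob C" "\<forall>f\<in>max_sieve C Y. Dom C f \<in> D \<longrightarrow> y f \<in> Val P (Dom C f)"
      "\<forall>f\<in>max_sieve C Y. \<forall>g\<in>Ar C. Dom C f \<in> D \<and> Dom C g \<in> D \<and> Cod C g = Dom C f \<longrightarrow>
         y (g \<Zsemi> f) = Res P g (y f)" for Y y
    using ext that unfolding extended_from_def by blast
  have sep: "s = t" if Y: "Y \<in> Ob C" and s: "s \<in> Val P Y" and t: "t \<in> Val P Y"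
    and eq: "\<And>f. f \<in> max_sieve C Y \<Longrightarrow> Dom C f \<in> D \<Longrightarrow> Res P f s = Res P f t" for Y s t
  proof -
    have "\<exists>!u. u \<in> Val P Y \<and> (\<forall>f\<in>max_sieve C Y. Dom C f \<in> D \<longrightarrow> Res P f u = Res P f t)"
      by (rule exu[OF Y]) (use t in \<open>auto simp: max_sieve_def presheafD[OF P]\<close>)
    then show ?thesis using s t eq by blast
  qed
  have "\<exists>!s. s \<in> Val P X \<and> (\<forall>f\<in>max_sieve C X. Dom C f \<in> D \<longrightarrow> Res P f s = x f)"
    by (rule exu[OF X]) (use x S' in \<open>blast+\<close>)
  then obtain s where s: "s \<in> Val P X" "\<And>f. f \<in> max_sieve C X \<Longrightarrow> Dom C f \<in> D \<Longrightarrow> Res P f s = x f"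
    by blast
  show "\<exists>!s. s \<in> Val P X \<and> (\<forall>f\<in>S. Res P f s = x f)"
  proof (rule ex1I[of _ s], intro conjI ballI)
    show "s \<in> Val P X" by (rule s)
    fix f assume f: "f \<in> S"
    show "Res P f s = x f"
    proof (rule sep[of "Dom C f"])
      show "Dom C f \<in> Ob C" "Res P f s \<in> Val P (Dom C f)" "x f \<in> Val P (Dom C f)"
        using f Sar[OF f] x s presheafD(1)[OF P] by (auto simp: Dom_in)
      fix g assume g: "g \<in> max_sieve C (Dom C f)" "Dom C g \<in> D"
      then have g': "g \<in> Ar C" "Cod C g = Dom C f" by (auto simp: max_sieve_def)
      have "Res P g (Res P f s) = Res P (g \<Zsemi> f) s"
        using presheafD(3)[OF P] g' Sar[OF f] s by simp
      also have "\<dots> = x (g \<Zsemi> f)"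
        using s(2)[of "g \<Zsemi> f"] g g' Sar[OF f] by (simp add: max_sieve_def Comp_in Cod_Comp Dom_Comp)
      also have "\<dots> = Res P g (x f)" using x f g' by blast
      finally show "Res P g (Res P f s) = Res P g (x f)" .
    qed
  next
    fix t assume t: "t \<in> Val P X \<and> (\<forall>f\<in>S. Res P f t = x f)"
    show "t = s"
      by (rule sep[OF X]) (use t s S' in auto)
  qed
qed

lemma sheaf_imp_extended:
  assumes sh: "is_sheaf C (full_topology C D) P" shows "extended_from C D P"
  unfolding extended_from_def
proof (intro conjI ballI allI impI)
  show P: "is_presheaf C P" using sh by (simp add: is_sheaf_def)
  fix X x
  assume X: "X \<in> Ob C"
    and x: "(\<forall>f\<in>max_sieve C X. Dom C f \<in> D \<longrightarrow> x f \<in> Val P (Dom C f)) \<and>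
      (\<forall>f\<in>max_sieve C X. \<forall>g\<in>Ar C. Dom C f \<in> D \<and> Dom C g \<in> D \<and> Cod C g = Dom C f \<longrightarrow>
          x (g \<Zsemi> f) = Res P g (x f))"
  have exu: "\<exists>!s. s \<in> Val P Y \<and> (\<forall>f\<in>S. Res P f s = y f)"
    if "Y \<in> Ob C" "S \<in> full_topology C D Y" "\<forall>f\<in>S. y f \<in> Val P (Dom C f)"
      "\<forall>f\<in>S. \<forall>g\<in>Ar C. Cod C g = Dom C f \<longrightarrow> y (g \<Zsemi> f) = Res P g (y f)" for Y S y
    by (rule sheaf_ex1[OF sh that])
  have sep: "s = t" if Y: "Y \<in> Ob C" and s: "s \<in> Val P Y" and t: "t \<in> Val P Y"
    and eq: "\<And>f. f \<in> max_sieve C Y \<Longrightarrow> Dom C f \<in> D \<Longrightarrow> Res P f s = Res P f t" for Y s t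
  proof -
    let ?S = "generated_sieve C D Y"
    have ar: "f \<in> Ar C \<and> Cod C f = Y" if "f \<in> ?S" for f
      using that sieve_generated[of Y D] by (auto simp: sieve_def max_sieve_def)
    have ex: "\<exists>!u. u \<in> Val P Y \<and> (\<forall>f\<in>?S. Res P f u = Res P f t)"
      by (rule exu[OF Y generated_full]) (use t ar in \<open>auto simp: presheafD[OF P]\<close>)
    have "Res P f s = Res P f t" if f: "f \<in> ?S" for f
    proof -
      obtain h k where hk: "f = h \<Zsemi> k" "h \<in> Ar C" "k \<in> Ar C" "Cod C h = Dom C k" "Cod C k = Y" "Dom C k \<in> D"
        using f by (auto simp: generated_sieve_def)
      then show ?thesis using eq[of k] s t by (simp add: presheafD[OF P] max_sieve_def)
    qed
    then show ?thesis using ex s t by blast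
  qed
  let ?S = "generated_sieve C D X"
  let ?R = "\<lambda>f u. u \<in> Val P (Dom C f) \<and> (\<forall>g\<in>max_sieve C (Dom C f). Dom C g \<in> D \<longrightarrow> Res P g u = x (g \<Zsemi> f))"
  define y where "y f = (SOME u. ?R f u)" for f
  have ar: "f \<in> Ar C \<and> Cod C f = X" if "f \<in> ?S" for f
    using that sieve_generated[of X D] by (auto simp: sieve_def max_sieve_def)
  have y: "?R f (y f)" if f: "f \<in> ?S" for f
  proof -
    obtain h k where hk: "f = h \<Zsemi> k" "h \<in> Ar C" "k \<in> Ar C" "Cod C h = Dom C k" "Cod C k = X" "Dom C k \<in> D"
      using f by (auto simp: generated_sieve_def)
    have k: "k \<in> max_sieve C X" "x k \<in> Val P (Dom C k)" using hk x by (auto simp: max_sieve_def)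
    have "?R f (Res P h (x k))"
    proof (intro conjI ballI impI)
      show "Res P h (x k) \<in> Val P (Dom C f)" using hk k by (simp add: presheafD[OF P] Dom_Comp)
      fix g assume "g \<in> max_sieve C (Dom C f)" and gD: "Dom C g \<in> D"
      then have g: "g \<in> Ar C" "Cod C g = Dom C h" using hk by (auto simp: max_sieve_def Dom_Comp)
      have "Res P g (Res P h (x k)) = Res P (g \<Zsemi> h) (x k)"
        using presheafD(3)[OF P, of g h "x k"] g hk k by simp
      also have "\<dots> = x ((g \<Zsemi> h) \<Zsemi> k)"
        using x k hk g gD by (auto simp: Comp_in Cod_Comp Dom_Comp)
      also have "\<dots> = x (g \<Zsemi> f)" using hk g by (simp add: Comp_assoc)
      finally show "Res P g (Res P h (x k)) = x (g \<Zsemi> f)" .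
    qed
    then show ?thesis unfolding y_def by (rule someI)
  qed
  have yx: "y f = x f" if f: "f \<in> max_sieve C X" "Dom C f \<in> D" for f
  proof -
    have fa: "f \<in> Ar C" using f by (simp add: max_sieve_def)
    have "Res P (Idt C (Dom C f)) (y f) = x (Idt C (Dom C f) \<Zsemi> f)"
      using y[OF generated_base[OF f]] f fa by (simp add: max_sieve_def Idt_in Dom_in Cod_Idt Dom_Idt)
    then show ?thesis using y[OF generated_base[OF f]] fa by (simp add: Idt_Comp presheafD[OF P] Dom_in)
  qed
  have "\<exists>!s. s \<in> Val P X \<and> (\<forall>f\<in>?S. Res P f s = y f)"
  proof (rule exu[OF X generated_full]; intro ballI impI)
    fix f g assume f: "f \<in> ?S" and g: "g \<in> Ar C" "Cod C g = Dom C f"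
    have gf: "g \<Zsemi> f \<in> ?S" using sieve_generated[of X D] f g by (auto simp: sieve_def)
    have fa: "f \<in> Ar C" using ar f by blast
    show "y (g \<Zsemi> f) = Res P g (y f)"
    proof (rule sep[of "Dom C g"])
      show "Dom C g \<in> Ob C" "y (g \<Zsemi> f) \<in> Val P (Dom C g)" "Res P g (y f) \<in> Val P (Dom C g)"
        using y[OF f] y[OF gf] g fa by (auto simp: Dom_in Dom_Comp presheafD[OF P])
      fix k assume "k \<in> max_sieve C (Dom C g)" and kD: "Dom C k \<in> D"
      then have k: "k \<in> Ar C" "Cod C k = Dom C g" by (auto simp: max_sieve_def)
      have "Res P k (y (g \<Zsemi> f)) = x (k \<Zsemi> (g \<Zsemi> f))"
        using y[OF gf] k kD g fa by (simp add: max_sieve_def Dom_Comp)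
      moreover have "Res P (k \<Zsemi> g) (y f) = x ((k \<Zsemi> g) \<Zsemi> f)"
        using y[OF f] k kD g fa by (simp add: max_sieve_def Dom_Comp Comp_in Cod_Comp)
      ultimately show "Res P k (y (g \<Zsemi> f)) = Res P k (Res P g (y f))"
        using presheafD(3)[OF P, of k g "y f"] k g fa y[OF f] by (simp add: Comp_assoc)
    qed
  qed (use y in blast)
  then obtain s where s: "s \<in> Val P X" "\<And>f. f \<in> ?S \<Longrightarrow> Res P f s = y f" by blast
  show "\<exists>!s. s \<in> Val P X \<and> (\<forall>f\<in>max_sieve C X. Dom C f \<in> D \<longrightarrow> Res P f s = x f)"
  proof (rule ex1I[of _ s], intro conjI ballI impI)
    show "s \<in> Val P X" by (rule s)
    show "Res P f s = x f" if "f \<in> max_sieve C X" "Dom C f \<in> D" for f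
      using that s(2) generated_base yx by simp
    fix t assume t: "t \<in> Val P X \<and> (\<forall>f\<in>max_sieve C X. Dom C f \<in> D \<longrightarrow> Res P f t = x f)"
    show "t = s" by (rule sep[OF X]) (use t s generated_base yx in auto)
  qed
qed

lemma closed_pull:
  assumes "closed_sieve C J (Cod C f) S" "f \<in> Ar C"
  shows "closed_sieve C J (Dom C f) (pull_sieve C f S)"
  unfolding closed_sieve_def
proof (intro conjI ballI impI)
  show "sieve C (Dom C f) (pull_sieve C f S)" using assms by (simp add: closed_sieve_def sieve_pull)
  fix g assume g: "g \<in> max_sieve C (Dom C f)" "pull_sieve C g (pull_sieve C f S) \<in> J (Dom C g)"
  then have "g \<in> Ar C" "Cod C g = Dom C f" by (auto simp: max_sieve_def)
  moreover from this have "g \<Zsemi> f \<in> S"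
    using assms g by (simp add: closed_sieve_def pull_pull max_sieve_def Comp_in Cod_Comp Dom_Comp)
  ultimately show "g \<in> pull_sieve C f S" by (simp add: pull_sieve_def)
qed

lemma closed_max: "closed_sieve C J X (max_sieve C X)"
  by (simp add: closed_sieve_def sieve_max)

lemma closed_presheaf: "is_presheaf C (closed_presheaf C J)"
  unfolding is_presheaf_def
proof (intro conjI ballI impI)
  fix f S assume "f \<in> Ar C" "S \<in> Val (closed_presheaf C J) (Cod C f)"
  then show "Res (closed_presheaf C J) f S \<in> Val (closed_presheaf C J) (Dom C f)"
    by (simp add: closed_presheaf_def closed_pull)
next
  fix X S assume "X \<in> Ob C" "S \<in> Val (closed_presheaf C J) X"
  then show "Res (closed_presheaf C J) (Idt C X) S = S"
    by (simp add: closed_presheaf_def closed_sieve_def pull_Idt)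
next
  fix g f S assume "g \<in> Ar C" "f \<in> Ar C" "Cod C g = Dom C f"
  then show "Res (closed_presheaf C J) (g \<Zsemi> f) S =
      Res (closed_presheaf C J) g (Res (closed_presheaf C J) f S)"
    by (simp add: closed_presheaf_def pull_pull)
qed

lemma closure_sieve:
  assumes J: "grothendieck_topology C J" and S: "sieve C X S" and X: "X \<in> Ob C"
  shows "closed_sieve C J X (sieve_closure C J X S)" "S \<subseteq> sieve_closure C J X S"
proof -
  let ?T = "sieve_closure C J X S"
  show "S \<subseteq> ?T"
  proof
    fix f assume f: "f \<in> S"
    then have "f \<in> Ar C" "Cod C f = X" using S by (auto simp: sieve_def max_sieve_def)
    then show "f \<in> ?T"
      using pull_eq_max[OF f S] topology_max[OF J] by (simp add: sieve_closure_def max_sieve_def Dom_in)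
  qed
  have sv: "sieve C X ?T"
    unfolding sieve_def
  proof (intro conjI ballI impI)
    fix f g assume "f \<in> ?T" and g: "g \<in> Ar C" "Cod C g = Dom C f"
    then have f: "f \<in> Ar C" "Cod C f = X" "pull_sieve C f S \<in> J (Dom C f)"
      by (auto simp: sieve_closure_def max_sieve_def)
    then have "pull_sieve C (g \<Zsemi> f) S \<in> J (Dom C g)"
      using topology_pull[OF J g(1), of "pull_sieve C f S"] g by (simp add: pull_pull)
    then show "g \<Zsemi> f \<in> ?T" using f g by (simp add: sieve_closure_def max_sieve_def Comp_in Cod_Comp Dom_Comp)
  qed (auto simp: sieve_closure_def)
  show "closed_sieve C J X ?T"
    unfolding closed_sieve_def
  proof (intro conjI ballI impI sv)
    fix f assume fm: "f \<in> max_sieve C X" and cov: "pull_sieve C f ?T \<in> J (Dom C f)"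
    then have f: "f \<in> Ar C" "Cod C f = X" by (auto simp: max_sieve_def)
    have "pull_sieve C f S \<in> J (Dom C f)"
    proof (rule topology_trans[OF J _ cov])
      show "Dom C f \<in> Ob C" "sieve C (Dom C f) (pull_sieve C f S)"
        using f S by (auto simp: Dom_in sieve_pull)
      fix g assume "g \<in> pull_sieve C f ?T"
      then have "g \<in> Ar C" "Cod C g = Dom C f" "g \<Zsemi> f \<in> ?T" by (auto simp: pull_sieve_def)
      then show "pull_sieve C g (pull_sieve C f S) \<in> J (Dom C g)"
        using f by (simp add: pull_pull sieve_closure_def Dom_Comp)
    qed
    then show "f \<in> ?T" using fm by (simp add: sieve_closure_def)
  qed
qed

lemma closed_sheaf:
  assumes J: "grothendieck_topology C J" shows "is_sheaf C J (closed_presheaf C J)"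
  unfolding is_sheaf_def
proof (intro conjI ballI allI impI closed_presheaf)
  fix X S x
  assume X: "X \<in> Ob C" and S: "S \<in> J X"
    and x: "(\<forall>f\<in>S. x f \<in> Val (closed_presheaf C J) (Dom C f)) \<and>
      (\<forall>f\<in>S. \<forall>g\<in>Ar C. Cod C g = Dom C f \<longrightarrow> x (g \<Zsemi> f) = Res (closed_presheaf C J) g (x f))"
  have xc: "closed_sieve C J (Dom C f) (x f)" if "f \<in> S" for f
    using x that by (auto simp: closed_presheaf_def)
  have xr: "x (g \<Zsemi> f) = pull_sieve C g (x f)" if "f \<in> S" "g \<in> Ar C" "Cod C g = Dom C f" for f g
    using x that by (auto simp: closed_presheaf_def)
  have Ssv: "sieve C X S" by (rule topology_sieve[OF J X S])
  then have Sar: "f \<in> Ar C \<and> Cod C f = X" if "f \<in> S" for f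
    using that by (auto simp: sieve_def max_sieve_def)
  have Scomp: "g \<Zsemi> f \<in> S" if "f \<in> S" "g \<in> Ar C" "Cod C g = Dom C f" for f g
    using that Ssv by (auto simp: sieve_def)
  define T0 where "T0 = {f \<in> S. Idt C (Dom C f) \<in> x f}"
  have mem: "g \<Zsemi> f \<in> T0 \<longleftrightarrow> g \<in> x f" if "f \<in> S" "g \<in> Ar C" "Cod C g = Dom C f" for f g
    using that Sar[of f]
    by (simp add: T0_def Scomp xr Dom_Comp mem_iff_Idt_pull)
  have pT0: "pull_sieve C f T0 = x f" if f: "f \<in> S" for f
  proof -
    have "g \<in> Ar C \<and> Cod C g = Dom C f" if "g \<in> x f" for g
      using that xc[OF f] by (auto simp: closed_sieve_def sieve_def max_sieve_def)
    then show ?thesis using mem[OF f] by (auto simp: pull_sieve_def)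
  qed
  have T0sv: "sieve C X T0"
    unfolding sieve_def
  proof (intro conjI ballI impI)
    show "T0 \<subseteq> max_sieve C X" using Sar by (auto simp: T0_def max_sieve_def)
    fix f g assume f: "f \<in> T0" and g: "g \<in> Ar C" "Cod C g = Dom C f"
    then have fS: "f \<in> S" "Idt C (Dom C f) \<in> x f" by (auto simp: T0_def)
    have "g \<Zsemi> Idt C (Dom C f) \<in> x f"
      using xc[OF fS(1)] fS(2) g Sar[OF fS(1)] by (auto simp: closed_sieve_def sieve_def Dom_Idt Dom_in)
    then show "g \<Zsemi> f \<in> T0" using mem[OF fS(1) g] g Comp_Idt[OF g(1)] by simp
  qed
  let ?T = "sieve_closure C J X T0"
  have T: "closed_sieve C J X ?T" by (rule closure_sieve[OF J T0sv X])
  have pT: "pull_sieve C f ?T = x f" if f: "f \<in> S" for f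
  proof
    have fa: "f \<in> Ar C" "Cod C f = X" using Sar[OF f] by auto
    have "x f = pull_sieve C f T0" using pT0[OF f] by simp
    also have "\<dots> \<subseteq> pull_sieve C f ?T" using closure_sieve(2)[OF J T0sv X] by (auto simp: pull_sieve_def)
    finally show "x f \<subseteq> pull_sieve C f ?T" .
    show "pull_sieve C f ?T \<subseteq> x f"
    proof
      fix g assume "g \<in> pull_sieve C f ?T"
      then have g: "g \<in> Ar C" "Cod C g = Dom C f" "g \<Zsemi> f \<in> ?T" by (auto simp: pull_sieve_def)
      then have "pull_sieve C g (x f) \<in> J (Dom C g)"
        using fa pT0[OF f, symmetric] by (simp add: pull_pull sieve_closure_def Dom_Comp)
      then show "g \<in> x f" using xc[OF f] g by (simp add: closed_sieve_def max_sieve_def)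
    qed
  qed
  have sub: "A \<subseteq> B" if A: "closed_sieve C J X A" and B: "closed_sieve C J X B"
    and eq: "\<And>f. f \<in> S \<Longrightarrow> pull_sieve C f A = pull_sieve C f B" for A B
  proof
    fix h assume h: "h \<in> A"
    then have hm: "h \<in> max_sieve C X" using A by (auto simp: closed_sieve_def sieve_def)
    then have ha: "h \<in> Ar C" "Cod C h = X" by (auto simp: max_sieve_def)
    have "pull_sieve C h S \<in> J (Dom C h)" using topology_pull[OF J] ha S by simp
    moreover have "sieve C (Dom C h) (pull_sieve C h B)"
      using B ha by (simp add: closed_sieve_def sieve_pull)
    moreover have "pull_sieve C h S \<subseteq> pull_sieve C h B"
    proof
      fix g assume "g \<in> pull_sieve C h S"
      then have g: "g \<in> Ar C" "Cod C g = Dom C h" "g \<Zsemi> h \<in> S" by (auto simp: pull_sieve_def)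
      have "g \<Zsemi> h \<in> A" using A h g by (auto simp: closed_sieve_def sieve_def)
      then have "g \<Zsemi> h \<in> B"
        using eq[OF g(3)] mem_iff_Idt_pull[of "g \<Zsemi> h" A] mem_iff_Idt_pull[of "g \<Zsemi> h" B] Sar[OF g(3)] by simp
      then show "g \<in> pull_sieve C h B" using g by (simp add: pull_sieve_def)
    qed
    ultimately have "pull_sieve C h B \<in> J (Dom C h)" using topology_mono[OF J] ha by (simp add: Dom_in)
    then show "h \<in> B" using B hm by (auto simp: closed_sieve_def)
  qed
  show "\<exists>!s. s \<in> Val (closed_presheaf C J) X \<and> (\<forall>f\<in>S. Res (closed_presheaf C J) f s = x f)"
  proof (rule ex1I[of _ ?T])
    show "?T \<in> Val (closed_presheaf C J) X \<and> (\<forall>f\<in>S. Res (closed_presheaf C J) f ?T = x f)"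
      using T pT by (simp add: closed_presheaf_def)
    fix t assume "t \<in> Val (closed_presheaf C J) X \<and> (\<forall>f\<in>S. Res (closed_presheaf C J) f t = x f)"
    then have t: "closed_sieve C J X t" "\<And>f. f \<in> S \<Longrightarrow> pull_sieve C f t = x f"
      by (auto simp: closed_presheaf_def)
    show "t = ?T" using sub[OF t(1) T] sub[OF T t(1)] t(2) pT by auto
  qed
qed

lemma topology_le_of_sheaf:
  assumes J: "grothendieck_topology C J" and K: "grothendieck_topology C K"
    and sh: "is_sheaf C K (closed_presheaf C J)" and X: "X \<in> Ob C"
  shows "K X \<subseteq> J X"
proof
  fix S assume S: "S \<in> K X"
  have Ssv: "sieve C X S" by (rule topology_sieve[OF K X S])
  let ?T = "sieve_closure C J X S"
  have T: "closed_sieve C J X ?T" "S \<subseteq> ?T" by (rule closure_sieve[OF J Ssv X])+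
  have Sar: "f \<in> Ar C \<and> Cod C f = X" if "f \<in> S" for f
    using that Ssv by (auto simp: sieve_def max_sieve_def)
  have pm: "pull_sieve C f A = max_sieve C (Dom C f)" if "f \<in> S" "sieve C X A" "S \<subseteq> A" for f A
    using pull_eq_max that by blast
  have "\<exists>!s. s \<in> Val (closed_presheaf C J) X \<and>
      (\<forall>f\<in>S. Res (closed_presheaf C J) f s = max_sieve C (Dom C f))"
  proof -
    have exu: "\<exists>!s. s \<in> Val (closed_presheaf C J) X \<and> (\<forall>f\<in>S. Res (closed_presheaf C J) f s = x f)"
      if "\<forall>f\<in>S. x f \<in> Val (closed_presheaf C J) (Dom C f)"
        "\<forall>f\<in>S. \<forall>g\<in>Ar C. Cod C g = Dom C f \<longrightarrow> x (g \<Zsemi> f) = Res (closed_presheaf C J) g (x f)" for x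
      by (rule sheaf_ex1[OF sh X S that])
    show ?thesis
    proof (rule exu[of "\<lambda>f. max_sieve C (Dom C f)"]; intro ballI impI)
      fix f assume "f \<in> S"
      show "max_sieve C (Dom C f) \<in> Val (closed_presheaf C J) (Dom C f)"
        by (simp add: closed_presheaf_def closed_max)
      fix g assume g: "g \<in> Ar C" "Cod C g = Dom C f"
      have "pull_sieve C g (max_sieve C (Dom C f)) = max_sieve C (Dom C g)"
        by (rule pull_eq_max[OF _ sieve_max]) (use g in \<open>simp add: max_sieve_def\<close>)
      then show "max_sieve C (Dom C (g \<Zsemi> f)) = Res (closed_presheaf C J) g (max_sieve C (Dom C f))"
        using g Sar[OF \<open>f \<in> S\<close>] by (simp add: closed_presheaf_def Dom_Comp)
    qed
  qed
  moreover have "?T \<in> Val (closed_presheaf C J) X \<and>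
      (\<forall>f\<in>S. Res (closed_presheaf C J) f ?T = max_sieve C (Dom C f))"
    using T pm[OF _ _ T(2)] by (simp add: closed_presheaf_def closed_sieve_def)
  moreover have "pull_sieve C f (max_sieve C X) = max_sieve C (Dom C f)" if f: "f \<in> S" for f
    by (rule pm[OF f sieve_max]) (use Ssv in \<open>simp add: sieve_def\<close>)
  then have "max_sieve C X \<in> Val (closed_presheaf C J) X \<and>
      (\<forall>f\<in>S. Res (closed_presheaf C J) f (max_sieve C X) = max_sieve C (Dom C f))"
    by (simp add: closed_presheaf_def closed_max)
  ultimately have "?T = max_sieve C X" by blast
  then have "Idt C X \<in> ?T" using X by (simp add: max_sieve_def Idt_in Cod_Idt)
  then show "S \<in> J X" using X Ssv by (simp add: sieve_closure_def Dom_Idt pull_Idt)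
qed

theorem rigid_iff_irreducible:
  assumes J: "grothendieck_topology C J"
  shows "rigid C J \<longleftrightarrow> (\<forall>X\<in>Ob C. generated_sieve C {Y. irreducible_obj C J Y} X \<in> J X)"
proof
  assume "rigid C J"
  then obtain D where D: "D \<subseteq> Ob C"
    and eq: "\<And>P :: ('o, 'a, 'a set) presheaf. is_sheaf C J P \<longleftrightarrow> extended_from C D P"
    unfolding rigid_def by blast
  let ?K = "full_topology C D"
  have JK: "J X = ?K X" if X: "X \<in> Ob C" for X
  proof
    show "J X \<subseteq> ?K X"
      by (rule topology_le_of_sheaf[OF full_topology J _ X])
        (simp add: eq sheaf_imp_extended closed_sheaf full_topology)
    show "?K X \<subseteq> J X"
      by (rule topology_le_of_sheaf[OF J full_topology _ X])
        (use eq closed_sheaf[OF J] extended_imp_sheaf in blast)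
  qed
  have irr: "irreducible_obj C J Y" if Y: "Y \<in> D" for Y
    unfolding irreducible_obj_def
  proof (intro conjI ballI)
    show YO: "Y \<in> Ob C" using Y D by blast
    fix S assume "S \<in> J Y"
    then have S: "sieve C Y S" "Idt C Y \<in> S"
      using JK[OF YO] Y YO by (auto simp: full_topology_def max_sieve_def Idt_in Dom_Idt Cod_Idt)
    show "S = max_sieve C Y"
      using pull_eq_max[OF S(2,1)] pull_Idt[OF YO S(1)] YO by (simp add: Dom_Idt)
  qed
  show "\<forall>X\<in>Ob C. generated_sieve C {Y. irreducible_obj C J Y} X \<in> J X"
    using JK irr by (auto simp: full_topology_def sieve_generated intro!: generated_base)
next
  assume cov: "\<forall>X\<in>Ob C. generated_sieve C {Y. irreducible_obj C J Y} X \<in> J X"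
  let ?D = "{Y. irreducible_obj C J Y}"
  have JK: "J X = full_topology C ?D X" if X: "X \<in> Ob C" for X
  proof
    show "J X \<subseteq> full_topology C ?D X"
    proof
      fix S assume S: "S \<in> J X"
      have "f \<in> S" if f: "f \<in> max_sieve C X" "irreducible_obj C J (Dom C f)" for f
      proof -
        have fa: "f \<in> Ar C" "Cod C f = X" using f by (auto simp: max_sieve_def)
        then have "pull_sieve C f S \<in> J (Dom C f)" using topology_pull[OF J] S by simp
        then have "pull_sieve C f S = max_sieve C (Dom C f)" using f by (simp add: irreducible_obj_def)
        then have "Idt C (Dom C f) \<in> pull_sieve C f S" using fa by (simp add: max_sieve_def Idt_in Cod_Idt Dom_in)
        then show ?thesis using fa by (simp add: mem_iff_Idt_pull)
      qed
      then show "S \<in> full_topology C ?D X" using topology_sieve[OF J X S] by (simp add: full_topology_def)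
    qed
    show "full_topology C ?D X \<subseteq> J X"
    proof
      fix S assume S: "S \<in> full_topology C ?D X"
      then have S': "sieve C X S" "\<And>f. f \<in> max_sieve C X \<Longrightarrow> Dom C f \<in> ?D \<Longrightarrow> f \<in> S"
        by (auto simp: full_topology_def)
      have "generated_sieve C ?D X \<subseteq> S"
      proof
        fix f assume "f \<in> generated_sieve C ?D X"
        then obtain h k where "f = h \<Zsemi> k" "h \<in> Ar C" "k \<in> Ar C" "Cod C h = Dom C k" "Cod C k = X" "Dom C k \<in> ?D"
          by (auto simp: generated_sieve_def)
        then show "f \<in> S" using S' by (auto simp: sieve_def max_sieve_def)
      qed
      then show "S \<in> J X" using topology_mono[OF J X _ S'(1)] cov X by blast
    qed
  qed
  have "is_sheaf C J P \<longleftrightarrow> is_sheaf C (full_topology C ?D) P" for P :: "('o, 'a, 'a set) presheaf"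
    using JK by (simp add: is_sheaf_def)
  then show "rigid C J"
    unfolding rigid_def
    by (intro exI[of _ ?D]) (auto simp: irreducible_obj_def intro: sheaf_imp_extended extended_imp_sheaf)
qed

end

end

(* The implications form a cycle SUR2 => stable universal rigidity => SUR3 => SUR1 => SUR2.
   A subcategory W of a category gives the topology in which S covers Y when every map h into Y
   from an object of W satisfies w h in S for some w in W. If this topology is rigid it has an
   irreducible object, which forces the identity of that object to factor through prescribed
   arrows of W. In a slice, W = a descending chain of objects yields the Artinian condition, and
   W = the powers of an endomorphism f yields s f t = 1 with t k = f^n for some k, hence splittings
   of idempotents and enough idempotents. For SUR3 => SUR1, replace f by s f, where s is the
   inclusion of a retract of its domain that is minimal among those not changing the image of f. *)
theory Submission
  imports Defs
begin

context category
begin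

section \<open>Strict chains in the poset reflection\<close>

lemma hom_preorder_refl: "A \<in> Ob C \<Longrightarrow> (A, A) \<in> hom_preorder C"
  unfolding hom_preorder_def using Idt_in Dom_Idt Cod_Idt by auto

lemma hom_preorder_trans:
  assumes "(A, B) \<in> hom_preorder C" "(B, D) \<in> hom_preorder C"
  shows "(A, D) \<in> hom_preorder C"
proof -
  obtain f g where "f \<in> Ar C" "g \<in> Ar C" "Dom C f = A" "Cod C f = B" "Dom C g = B" "Cod C g = D"
    and "A \<in> Ob C" "D \<in> Ob C"
    using assms by (auto simp: hom_preorder_def)
  then show ?thesis
    unfolding hom_preorder_def
    by (auto intro!: bexI[of _ "f \<Zsemi> g"] simp: Comp_in Dom_Comp Cod_Comp)
qed

lemma equiv_hom_preorder: "equiv (Ob C) (hom_preorder C \<inter> (hom_preorder C)\<inverse>)"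
proof (rule equivI)
  show "hom_preorder C \<inter> (hom_preorder C)\<inverse> \<subseteq> Ob C \<times> Ob C"
    by (auto simp: hom_preorder_def)
  show "refl_on (Ob C) (hom_preorder C \<inter> (hom_preorder C)\<inverse>)"
    by (auto simp: refl_on_def hom_preorder_refl)
  show "sym (hom_preorder C \<inter> (hom_preorder C)\<inverse>)" by (auto simp: sym_def)
  show "trans (hom_preorder C \<inter> (hom_preorder C)\<inverse>)"
    unfolding trans_def using hom_preorder_trans by blast
qed

text \<open>Choosing a representative of each class, or passing to the class of each object, turns
  one kind of chain into the other. Comparable consecutive classes coincide exactly when there is
  also an arrow back, so later arguments never meet the quotient.\<close>

lemma artinian_poset_reflection_iff:
  "artinian (poset_reflection C) (poset_reflection_le C) \<longleftrightarrow>
    \<not> (\<exists>A :: nat \<Rightarrow> 'o. \<forall>n. (A (Suc n), A n) \<in> hom_preorder C \<and> (A n, A (Suc n)) \<notin> hom_preorder C)"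
proof -
  let ?E = "hom_preorder C \<inter> (hom_preorder C)\<inverse>"
  have "\<exists>A :: nat \<Rightarrow> 'o. \<forall>n. (A (Suc n), A n) \<in> hom_preorder C \<and> (A n, A (Suc n)) \<notin> hom_preorder C"
    if P: "\<And>n. s n \<in> poset_reflection C" and le: "\<And>n. (s (Suc n), s n) \<in> poset_reflection_le C"
      and ne: "\<And>n. s (Suc n) \<noteq> s n" for s :: "nat \<Rightarrow> 'o set"
  proof -
    have "\<exists>A. A \<in> s n" for n
      using in_quotient_imp_non_empty[OF equiv_hom_preorder] P[of n] by (auto simp: poset_reflection_def)
    then obtain A where A: "A n \<in> s n" for n by metis
    have rel: "(x, y) \<in> ?E" if "x \<in> s n" "y \<in> s n" for x y n
      using quotient_eq_iff[OF equiv_hom_preorder _ _ that] P by (auto simp: poset_reflection_def)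
    have "(A (Suc n), A n) \<in> hom_preorder C \<and> (A n, A (Suc n)) \<notin> hom_preorder C" for n
    proof
      obtain B B' where B: "B \<in> s (Suc n)" "B' \<in> s n" "(B, B') \<in> hom_preorder C"
        using le[of n] by (auto simp: poset_reflection_le_def)
      show H: "(A (Suc n), A n) \<in> hom_preorder C"
        using rel[OF A B(1)] rel[OF B(2) A] B(3) hom_preorder_trans by blast
      show "(A n, A (Suc n)) \<notin> hom_preorder C"
      proof
        assume "(A n, A (Suc n)) \<in> hom_preorder C"
        then have "s n = s (Suc n)"
          using quotient_eqI[OF equiv_hom_preorder _ _ A[of n] A[of "Suc n"]] P H
          by (auto simp: poset_reflection_def)
        then show False using ne[of n] by simp
      qed
    qed
    then show ?thesis by blast
  qed
  moreover have "\<exists>s :: nat \<Rightarrow> 'o set. \<forall>n. s n \<in> poset_reflection C \<and>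
      (s (Suc n), s n) \<in> poset_reflection_le C \<and> s (Suc n) \<noteq> s n"
    if A: "\<And>n. (A (Suc n), A n) \<in> hom_preorder C" "\<And>n. (A n, A (Suc n)) \<notin> hom_preorder C"
    for A :: "nat \<Rightarrow> 'o"
  proof -
    have Ob: "A n \<in> Ob C" for n using A(1)[of n] by (auto simp: hom_preorder_def)
    have self: "A n \<in> ?E `` {A n}" for n using hom_preorder_refl[OF Ob] by blast
    have cls: "?E `` {A n} \<in> poset_reflection C" for n
      unfolding poset_reflection_def using Ob by (rule quotientI)
    have "(?E `` {A (Suc n)}, ?E `` {A n}) \<in> poset_reflection_le C" for n
      unfolding poset_reflection_le_def using cls self A(1) by blast
    moreover have "?E `` {A (Suc n)} \<noteq> ?E `` {A n}" for n
      using eq_equiv_class[OF _ equiv_hom_preorder Ob, of "A (Suc n)" n] A(2) by blast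
    ultimately show ?thesis using cls by (intro exI[of _ "\<lambda>n. ?E `` {A n}"]) simp
  qed
  ultimately show ?thesis unfolding artinian_def by metis
qed

section \<open>Images as principal sieves\<close>

lemma im_iff: "g \<in> im C f \<longleftrightarrow> (\<exists>h\<in>Ar C. Cod C h = Dom C f \<and> g = h \<Zsemi> f)"
  by (auto simp: im_def)

lemma sieve_im: "f \<in> Ar C \<Longrightarrow> sieve C (Cod C f) (im C f)"
proof -
  assume f: "f \<in> Ar C"
  have "g \<Zsemi> (h \<Zsemi> f) \<in> im C f" if "h \<in> Ar C" "Cod C h = Dom C f" "g \<in> Ar C" "Cod C g = Dom C (h \<Zsemi> f)" for g h
    using that f unfolding im_iff
    by (intro bexI[of _ "g \<Zsemi> h"]) (auto simp: Comp_in Dom_Comp Cod_Comp Comp_assoc)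
  then show ?thesis using f by (auto simp: sieve_def im_iff max_sieve_def Comp_in Cod_Comp)
qed

text \<open>This is the Yoneda argument: \<open>f\<close> lies in \<open>im C f\<close> via the
  identity, so everything depends on whether this one arrow belongs to the sieve
  \<open>im C g\<close>.\<close>

lemma im_subset_iff:
  assumes "f \<in> Ar C" "g \<in> Ar C" "Cod C f = Cod C g"
  shows "im C f \<subseteq> im C g \<longleftrightarrow> (\<exists>h\<in>Ar C. Dom C h = Dom C f \<and> Cod C h = Dom C g \<and> f = h \<Zsemi> g)"
proof
  assume "im C f \<subseteq> im C g"
  moreover have "f \<in> im C f" using assms Idt_Comp[of f] unfolding im_iff
    by (intro bexI[of _ "Idt C (Dom C f)"]) (auto simp: Idt_in Dom_in Cod_Idt)
  ultimately have "f \<in> im C g" by (rule subsetD)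
  then obtain h where h: "h \<in> Ar C" "Cod C h = Dom C g" "f = h \<Zsemi> g" by (auto simp: im_iff)
  then show "\<exists>h\<in>Ar C. Dom C h = Dom C f \<and> Cod C h = Dom C g \<and> f = h \<Zsemi> g"
    using Dom_Comp[of h g] assms(2) by (intro bexI[of _ h]) auto
next
  assume "\<exists>h\<in>Ar C. Dom C h = Dom C f \<and> Cod C h = Dom C g \<and> f = h \<Zsemi> g"
  then have "f \<in> im C g" by (auto simp: im_iff)
  then show "im C f \<subseteq> im C g" using sieve_im[OF assms(2)] by (auto simp: sieve_def im_iff[of _ f])
qed

lemma im_Comp_subset: "\<lbrakk>h \<in> Ar C; f \<in> Ar C; Cod C h = Dom C f\<rbrakk> \<Longrightarrow> im C (h \<Zsemi> f) \<subseteq> im C f"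
  by (subst im_subset_iff) (auto simp: Comp_in Cod_Comp Dom_Comp)

text \<open>A section \<open>s\<close> of \<open>r\<close> recovers \<open>f\<close> as
  \<open>s (r f)\<close>. In the game this means that Cleaner never changes the image of the
  position.\<close>

lemma im_split_epi_Comp:
  assumes "split_epi C r" "f \<in> Ar C" "Cod C r = Dom C f" shows "im C (r \<Zsemi> f) = im C f"
proof
  obtain s where s: "s \<in> Ar C" "Dom C s = Cod C r" "Cod C s = Dom C r" "s \<Zsemi> r = Idt C (Cod C r)"
    and r: "r \<in> Ar C"
    using assms(1) by (auto simp: split_epi_def)
  show "im C (r \<Zsemi> f) \<subseteq> im C f" by (rule im_Comp_subset[OF r assms(2,3)])
  have "f = s \<Zsemi> (r \<Zsemi> f)" using s r assms Idt_Comp[of f] Comp_assoc[of s r f] by simp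
  then show "im C f \<subseteq> im C (r \<Zsemi> f)"
    using im_Comp_subset[of s "r \<Zsemi> f"] s r assms by (simp add: Comp_in Dom_Comp)
qed

lemma split_epi_left_factor:
  assumes "h \<in> Ar C" "f \<in> Ar C" "Cod C h = Dom C f" "split_epi C (h \<Zsemi> f)" shows "split_epi C f"
proof -
  obtain s where "s \<in> Ar C" "Dom C s = Cod C f" "Cod C s = Dom C h" "s \<Zsemi> (h \<Zsemi> f) = Idt C (Cod C f)"
    using assms by (auto simp: split_epi_def Dom_Comp Cod_Comp)
  then show ?thesis using assms unfolding split_epi_def
    by (auto intro!: bexI[of _ "s \<Zsemi> h"] simp: Comp_in Dom_Comp Cod_Comp Comp_assoc)
qed

lemma split_epi_iff_im:
  assumes "f \<in> Ar C" shows "split_epi C f \<longleftrightarrow> im C f = max_sieve C (Cod C f)"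
proof
  assume f: "split_epi C f"
  have "im C (Idt C (Cod C f)) = max_sieve C (Cod C f)"
  proof
    show "im C (Idt C (Cod C f)) \<subseteq> max_sieve C (Cod C f)"
      using sieve_im[OF Idt_in[OF Cod_in[OF assms]]] assms by (simp add: sieve_def Cod_Idt Cod_in)
    show "max_sieve C (Cod C f) \<subseteq> im C (Idt C (Cod C f))"
    proof
      fix g assume "g \<in> max_sieve C (Cod C f)"
      then show "g \<in> im C (Idt C (Cod C f))"
        using Comp_Idt[of g] assms unfolding im_iff by (intro bexI[of _ g]) (auto simp: max_sieve_def Dom_Idt Cod_in)
    qed
  qed
  then show "im C f = max_sieve C (Cod C f)"
    using im_split_epi_Comp[OF f Idt_in, of "Cod C f"] assms by (simp add: Comp_Idt Cod_in Dom_Idt)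
next
  assume "im C f = max_sieve C (Cod C f)"
  then have "Idt C (Cod C f) \<in> im C f" using assms by (simp add: max_sieve_def Idt_in Cod_Idt Cod_in)
  then obtain s where "s \<in> Ar C" "Cod C s = Dom C f" "s \<Zsemi> f = Idt C (Cod C f)" by (auto simp: im_iff)
  moreover from this have "Dom C s = Cod C f" using Dom_Comp[of s f] assms by (simp add: Dom_Idt Cod_in)
  ultimately show "split_epi C f" using assms by (auto simp: split_epi_def)
qed

text \<open>A slice arrow is a factorization, so the poset reflection of the slice over
  \<open>X\<close> is the poset of principal sieves on \<open>X\<close>. The Artinian condition
  thereby becomes a statement about images only.\<close>

lemma slice_hom_preorder_iff:
  "(f, g) \<in> hom_preorder (slice C X) \<longleftrightarrow>
    f \<in> max_sieve C X \<and> g \<in> max_sieve C X \<and> im C f \<subseteq> im C g"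
proof -
  have "im C f \<subseteq> im C g \<longleftrightarrow> (\<exists>h\<in>Ar C. Cod C h = Dom C g \<and> h \<Zsemi> g = f)"
    if "f \<in> max_sieve C X" "g \<in> max_sieve C X"
    using that im_subset_iff[of f g] Dom_Comp unfolding max_sieve_def by auto
  then show ?thesis by (auto simp: hom_preorder_def slice_def max_sieve_def)
qed

lemma slices_artinian_iff:
  "slices_artinian C \<longleftrightarrow>
    (\<forall>X\<in>Ob C. \<not> (\<exists>s. \<forall>n. s n \<in> max_sieve C X \<and> im C (s (Suc n)) \<subset> im C (s n)))"
proof -
  have "artinian (poset_reflection (slice C X)) (poset_reflection_le (slice C X)) \<longleftrightarrow>
      \<not> (\<exists>s. \<forall>n. s n \<in> max_sieve C X \<and> im C (s (Suc n)) \<subset> im C (s n))" if "X \<in> Ob C" for X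
    unfolding category.artinian_poset_reflection_iff[OF category_slice[OF that]] slice_hom_preorder_iff
      psubset_eq set_eq_subset by (intro arg_cong[of _ _ Not] ex_cong1) blast
  then show ?thesis by (simp add: slices_artinian_def)
qed

text \<open>Absence of infinite descent makes strict inclusion of images well-founded. Minimality is
  up to equality of images, since different arrows may have the same one.\<close>

lemma slices_artinian_minimal:
  assumes "slices_artinian C" "X \<in> Ob C" "Q \<subseteq> max_sieve C X" "q \<in> Q"
  obtains m where "m \<in> Q" "\<And>g. g \<in> Q \<Longrightarrow> im C g \<subseteq> im C m \<Longrightarrow> im C g = im C m"
proof -
  have "wf {(f, g). g \<in> max_sieve C X \<and> im C f \<subset> im C g}"
    unfolding wf_iff_no_infinite_down_chain
    using assms(1,2) unfolding slices_artinian_iff by blast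
  then have "\<exists>m\<in>Q. \<forall>g. (g, m) \<in> {(f, g). g \<in> max_sieve C X \<and> im C f \<subset> im C g} \<longrightarrow> g \<notin> Q"
    using assms(4) by (simp add: wf_eq_minimal) blast
  then show thesis using assms(3) that by blast
qed


section \<open>Consequences of universal rigidity\<close>

text \<open>When \<open>W\<close> is a subcategory on \<open>D\<close>, the condition also applies
  to \<open>v h\<close> for \<open>v\<close> in \<open>W\<close>, so the arrows \<open>w\<close> of
  \<open>W\<close> with \<open>w h\<close> in \<open>S\<close> form a dense sieve of
  \<open>W\<close>. This is the double negation topology of \<open>W\<close>, transferred along its
  inclusion.\<close>

definition subcat_topology :: "'o set \<Rightarrow> 'a set \<Rightarrow> 'o \<Rightarrow> 'a set set" where
  "subcat_topology D W X = {S. sieve C X S \<and>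
    (\<forall>h\<in>max_sieve C X. Dom C h \<in> D \<longrightarrow> (\<exists>w\<in>W. Cod C w = Dom C h \<and> w \<Zsemi> h \<in> S))}"

text \<open>The identities in \<open>W\<close> make maximal sieves cover; composing a test arrow
  with \<open>f\<close> gives stability under pullback; closure of \<open>W\<close> under
  composition gives transitivity.\<close>

lemma subcat_topology:
  assumes W: "W \<subseteq> Ar C" "\<And>w. w \<in> W \<Longrightarrow> Dom C w \<in> D" "\<And>X. X \<in> D \<Longrightarrow> Idt C X \<in> W" "D \<subseteq> Ob C"
    and comp: "\<And>v w. \<lbrakk>v \<in> W; w \<in> W; Cod C v = Dom C w\<rbrakk> \<Longrightarrow> v \<Zsemi> w \<in> W"
  shows "grothendieck_topology C (subcat_topology D W)"
  unfolding grothendieck_topology_def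
proof (intro conjI ballI allI impI)
  fix X S assume "S \<in> subcat_topology D W X"
  then show "sieve C X S" by (simp add: subcat_topology_def)
next
  fix X
  have "\<exists>w\<in>W. Cod C w = Dom C h \<and> w \<Zsemi> h \<in> max_sieve C X"
    if "h \<in> max_sieve C X" "Dom C h \<in> D" for h
    using that W by (intro bexI[of _ "Idt C (Dom C h)"]) (auto simp: Cod_Idt Idt_Comp max_sieve_def Dom_in)
  then show "max_sieve C X \<in> subcat_topology D W X" by (auto simp: subcat_topology_def sieve_max)
next
  fix f S assume f: "f \<in> Ar C" and S: "S \<in> subcat_topology D W (Cod C f)"
  have "\<exists>w\<in>W. Cod C w = Dom C h \<and> w \<Zsemi> h \<in> pull_sieve C f S"
    if "h \<in> max_sieve C (Dom C f)" "Dom C h \<in> D" for h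
  proof -
    have h: "h \<in> Ar C" "Cod C h = Dom C f" using that by (auto simp: max_sieve_def)
    then have "h \<Zsemi> f \<in> max_sieve C (Cod C f)" "Dom C (h \<Zsemi> f) = Dom C h"
      using f by (auto simp: max_sieve_def Comp_in Cod_Comp Dom_Comp)
    then obtain w where "w \<in> W" "Cod C w = Dom C h" "w \<Zsemi> (h \<Zsemi> f) \<in> S"
      using S \<open>Dom C h \<in> D\<close> by (auto simp: subcat_topology_def)
    moreover from this have "w \<in> Ar C" using W by blast
    ultimately show ?thesis
      using h f by (intro bexI[of _ w]) (auto simp: pull_sieve_def Comp_in Cod_Comp Comp_assoc)
  qed
  then show "pull_sieve C f S \<in> subcat_topology D W (Dom C f)"
    using S f by (auto simp: subcat_topology_def sieve_pull)
next
  fix X S R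
  assume S: "S \<in> subcat_topology D W X"
    and R: "sieve C X R \<and> (\<forall>f\<in>S. pull_sieve C f R \<in> subcat_topology D W (Dom C f))"
  have "\<exists>w\<in>W. Cod C w = Dom C h \<and> w \<Zsemi> h \<in> R" if hm: "h \<in> max_sieve C X" "Dom C h \<in> D" for h
  proof -
    have h: "h \<in> Ar C" "Cod C h = X" using hm by (auto simp: max_sieve_def)
    obtain w where w: "w \<in> W" "Cod C w = Dom C h" "w \<Zsemi> h \<in> S"
      using S hm by (auto simp: subcat_topology_def)
    then have wA: "w \<in> Ar C" "Dom C w \<in> D" "Dom C w \<in> Ob C" using W by auto
    \<comment> \<open>The pullback of \<open>R\<close> along \<open>w h\<close> covers
      \<open>Dom C w\<close>, an object of \<open>D\<close>, so it can be tested at the identity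
      there. The resulting \<open>v\<close> yields the required arrow \<open>v w\<close> of
      \<open>W\<close>.\<close>
    have "pull_sieve C (w \<Zsemi> h) R \<in> subcat_topology D W (Dom C w)"
      using R w wA h by (metis Dom_Comp)
    moreover have "Idt C (Dom C w) \<in> max_sieve C (Dom C w)" "Dom C (Idt C (Dom C w)) = Dom C w"
      using wA by (auto simp: max_sieve_def Idt_in Cod_Idt Dom_Idt)
    ultimately obtain v where v: "v \<in> W" "Cod C v = Dom C w"
      "v \<Zsemi> Idt C (Dom C w) \<in> pull_sieve C (w \<Zsemi> h) R"
      using wA(2) unfolding subcat_topology_def by fastforce
    then have vA: "v \<in> Ar C" using W by blast
    then have "v \<Zsemi> (w \<Zsemi> h) \<in> R" using v Comp_Idt[of v] by (auto simp: pull_sieve_def)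
    then have "(v \<Zsemi> w) \<Zsemi> h \<in> R" using vA wA w h v by (simp add: Comp_assoc)
    then show ?thesis
      using comp[OF v(1) w(1) v(2)] vA wA v w by (intro bexI[of _ "v \<Zsemi> w"]) (auto simp: Cod_Comp)
  qed
  then show "R \<in> subcat_topology D W X" using R by (auto simp: subcat_topology_def)
qed

text \<open>An irreducible object \<open>K\<close> of the topology is covered by the composites \<open>w \<Zsemi> t\<close> with \<open>w\<close>
  in \<open>R\<close>, hence the identity of \<open>K\<close> factors through one of them.\<close>

lemma universally_rigid_retract:
  assumes ur: "universally_rigid C"
    and W: "W \<subseteq> Ar C" "\<And>w. w \<in> W \<Longrightarrow> Dom C w \<in> D" "\<And>X. X \<in> D \<Longrightarrow> Idt C X \<in> W" "D \<subseteq> Ob C"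
    and comp: "\<And>v w. \<lbrakk>v \<in> W; w \<in> W; Cod C v = Dom C w\<rbrakk> \<Longrightarrow> v \<Zsemi> w \<in> W"
    and ne: "D \<noteq> {}"
    and R: "R \<subseteq> W" "\<And>X. X \<in> D \<Longrightarrow> \<exists>w\<in>R. Cod C w = X"
  obtains h w t where "w \<in> R" "h \<in> Ar C" "t \<in> Ar C" "Cod C h = Dom C w" "Cod C w = Dom C t"
    "Cod C t = Dom C h" "h \<Zsemi> (w \<Zsemi> t) = Idt C (Dom C h)"
proof -
  let ?J = "subcat_topology D W"
  have J: "grothendieck_topology C ?J" using W comp by (rule subcat_topology)
  obtain X where X: "X \<in> D" "X \<in> Ob C" using ne W by blast
  have "generated_sieve C {Y. irreducible_obj C ?J Y} X \<in> ?J X"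
    using ur J X rigid_iff_irreducible by (simp add: universally_rigid_def)
  \<comment> \<open>Testing the cover at the identity of an object of \<open>D\<close> shows that it
    is nonempty, hence that some irreducible object exists.\<close>
  moreover have "Idt C X \<in> max_sieve C X" "Dom C (Idt C X) \<in> D"
    using X by (auto simp: max_sieve_def Idt_in Cod_Idt Dom_Idt)
  ultimately have "generated_sieve C {Y. irreducible_obj C ?J Y} X \<noteq> {}"
    unfolding subcat_topology_def by blast
  then obtain K where K: "irreducible_obj C ?J K" unfolding generated_sieve_def by blast
  then have KO: "K \<in> Ob C" by (simp add: irreducible_obj_def)
  \<comment> \<open>The sieve on \<open>K\<close> generated by all \<open>w t\<close> with
    \<open>w\<close> in \<open>R\<close>. It covers because \<open>R\<close> has an arrow into the
    domain of every test arrow \<open>t\<close>.\<close>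
  define S where "S = {h \<Zsemi> (w \<Zsemi> t) |h w t. w \<in> R \<and> h \<in> Ar C \<and> t \<in> Ar C \<and> Cod C h = Dom C w \<and>
    Cod C w = Dom C t \<and> Cod C t = K}"
  have RA: "w \<in> Ar C" if "w \<in> R" for w using that R W by blast
  have "S \<in> ?J K"
    unfolding subcat_topology_def sieve_def
  proof (intro CollectI conjI ballI impI)
    show "S \<subseteq> max_sieve C K" using RA by (auto simp: S_def max_sieve_def Comp_in Cod_Comp Dom_Comp)
    fix f g assume "f \<in> S" and g: "g \<in> Ar C" "Cod C g = Dom C f"
    then obtain h w t where hwt: "f = h \<Zsemi> (w \<Zsemi> t)" "w \<in> R" "h \<in> Ar C" "t \<in> Ar C" "Cod C h = Dom C w"
      "Cod C w = Dom C t" "Cod C t = K" by (auto simp: S_def)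
    then have "g \<Zsemi> f = (g \<Zsemi> h) \<Zsemi> (w \<Zsemi> t)" "g \<Zsemi> h \<in> Ar C" "Cod C (g \<Zsemi> h) = Dom C w"
      using g RA[OF hwt(2)] by (auto simp: Comp_in Cod_Comp Dom_Comp Comp_assoc)
    then show "g \<Zsemi> f \<in> S" using hwt unfolding S_def by blast
  next
    fix t assume t: "t \<in> max_sieve C K" "Dom C t \<in> D"
    then obtain w where w: "w \<in> R" "Cod C w = Dom C t" using R by blast
    have "w \<Zsemi> t = Idt C (Dom C w) \<Zsemi> (w \<Zsemi> t)" "Idt C (Dom C w) \<in> Ar C" "Cod C (Idt C (Dom C w)) = Dom C w"
      using w t RA[OF w(1)] Idt_Comp[of "w \<Zsemi> t"]
      by (auto simp: max_sieve_def Comp_in Dom_Comp Idt_in Cod_Idt Dom_in)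
    then have "w \<Zsemi> t \<in> S" using w t unfolding S_def max_sieve_def by blast
    then show "\<exists>w\<in>W. Cod C w = Dom C t \<and> w \<Zsemi> t \<in> S" using w R by blast
  qed
  then have "S = max_sieve C K" using K by (simp add: irreducible_obj_def)
  then have "Idt C K \<in> S" using KO by (simp add: max_sieve_def Idt_in Cod_Idt)
  then obtain h w t where hwt: "Idt C K = h \<Zsemi> (w \<Zsemi> t)" "w \<in> R" "h \<in> Ar C" "t \<in> Ar C" "Cod C h = Dom C w"
      "Cod C w = Dom C t" "Cod C t = K" by (auto simp: S_def)
  moreover from this have "Dom C h = K"
    using Dom_Comp[of h "w \<Zsemi> t"] Dom_Idt[OF KO] RA[OF hwt(2)] by (simp add: Comp_in Dom_Comp)
  ultimately show thesis using that by metis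
qed

text \<open>Take for \<open>W\<close> the full subcategory on a strict chain and for
  \<open>R\<close> its arrows that admit no arrow back; the steps of the chain are such arrows. If
  the identity factors as \<open>h w t\<close> with \<open>w\<close> in \<open>R\<close>, then
  \<open>t h\<close> is an arrow back, a contradiction.\<close>

lemma universally_rigid_imp_artinian:
  assumes "universally_rigid C"
  shows "artinian (poset_reflection C) (poset_reflection_le C)"
  unfolding artinian_poset_reflection_iff
proof
  assume "\<exists>A :: nat \<Rightarrow> 'o. \<forall>n. (A (Suc n), A n) \<in> hom_preorder C \<and> (A n, A (Suc n)) \<notin> hom_preorder C"
  then obtain A :: "nat \<Rightarrow> 'o" where
    A: "\<And>n. (A (Suc n), A n) \<in> hom_preorder C" "\<And>n. (A n, A (Suc n)) \<notin> hom_preorder C" by blast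
  have Ob: "A n \<in> Ob C" for n using A(1)[of n] by (simp add: hom_preorder_def)
  define D where "D = range A"
  define W where "W = {w \<in> Ar C. Dom C w \<in> D \<and> Cod C w \<in> D}"
  define R where "R = {w \<in> W. (Cod C w, Dom C w) \<notin> hom_preorder C}"
  show False
  proof (rule universally_rigid_retract[of W D R])
    show "\<exists>w\<in>R. Cod C w = X" if "X \<in> D" for X
    proof -
      obtain n where n: "X = A n" using \<open>X \<in> D\<close> D_def by blast
      obtain w where "w \<in> Ar C" "Dom C w = A (Suc n)" "Cod C w = A n"
        using A(1)[of n] by (auto simp: hom_preorder_def)
      then show ?thesis using A(2)[of n] n by (intro bexI[of _ w]) (auto simp: R_def W_def D_def)
    qed
    fix h w t
    assume w: "w \<in> R" and ht: "h \<in> Ar C" "t \<in> Ar C" "Cod C h = Dom C w" "Cod C w = Dom C t" "Cod C t = Dom C h"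
    then have "t \<Zsemi> h \<in> Ar C" "Dom C (t \<Zsemi> h) = Cod C w" "Cod C (t \<Zsemi> h) = Dom C w"
      by (auto simp: Comp_in Dom_Comp Cod_Comp)
    then have "(Cod C w, Dom C w) \<in> hom_preorder C"
      using Dom_in[of "t \<Zsemi> h"] Cod_in[of "t \<Zsemi> h"] by (auto simp: hom_preorder_def)
    then show False using w by (simp add: R_def)
  qed (use assms Ob in \<open>auto simp: W_def R_def D_def Idt_in Dom_Idt Cod_Idt Comp_in Dom_Comp Cod_Comp\<close>)
qed

section \<open>Endomorphisms in slices and the condition SUR3\<close>

lemma monoid_End:
  assumes "X \<in> Ob C" shows "monoid (End_monoid C X)"
  by (rule monoidI) (use assms in \<open>auto simp: End_monoid_def Comp_in Dom_Comp Cod_Comp Idt_in Dom_Idt Cod_Idt Comp_assoc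
      dest: Idt_Comp Comp_Idt\<close>)

text \<open>The subcategory used here has the objects \<open>f^n\<close> of the slice and the arrows
  \<open>f^j : f^(n + j) \<rightarrow> f^n\<close>; the prescribed arrows are those with \<open>j = 1\<close>.\<close>

lemma universally_rigid_slice_endo:
  assumes X: "X \<in> Ob C" and ur: "universally_rigid (slice C X)"
    and f: "f \<in> Ar C" "Dom C f = X" "Cod C f = X"
  obtains n t k s where "t \<in> Ar C" "Dom C t = X" "Cod C t = Dom C k" "k \<in> Ar C" "Cod C k = X"
    "s \<in> Ar C" "Dom C s = Dom C k" "Cod C s = X"
    "t \<Zsemi> k = f [^]\<^bsub>End_monoid C X\<^esub> (n::nat)" "s \<Zsemi> (f \<Zsemi> t) = Idt C (Dom C k)"
proof -
  interpret M: monoid "End_monoid C X" by (rule monoid_End[OF X])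
  let ?p = "\<lambda>n::nat. f [^]\<^bsub>End_monoid C X\<^esub> n"
  have fM: "f \<in> carrier (End_monoid C X)" using f by (simp add: End_monoid_def)
  have p: "?p n \<in> Ar C" "Dom C (?p n) = X" "Cod C (?p n) = X" for n
    using M.nat_pow_closed[OF fM, of n] by (simp_all add: End_monoid_def)
  have p_add: "?p i \<Zsemi> ?p j = ?p (i + j)" for i j
    using M.nat_pow_mult[OF fM, of i j] by (simp add: End_monoid_def)
  have p0: "?p 0 = Idt C X" by (simp add: End_monoid_def)
  have p1: "?p 1 = f" using Idt_Comp[OF f(1)] f by (simp add: End_monoid_def)
  define D where "D = range ?p"
  define W where "W = {(?p j, ?p n) |j n. True}"
  define R where "R = {(f, ?p n) |n. True}"
  interpret S: category "slice C X" by (rule category_slice[OF X])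
  show thesis
  proof (rule S.universally_rigid_retract[OF ur, of W D R])
    show "W \<subseteq> Ar (slice C X)" using p by (auto simp: W_def slice_def)
    show "Dom (slice C X) w \<in> D" if "w \<in> W" for w
      using that by (auto simp: W_def D_def slice_def p_add)
    show "Idt (slice C X) g \<in> W" if "g \<in> D" for g
    proof -
      obtain n where "g = ?p n" using \<open>g \<in> D\<close> by (auto simp: D_def)
      then have "Idt (slice C X) g = (?p 0, ?p n)" using p0 p by (simp add: slice_def)
      then show ?thesis unfolding W_def by blast
    qed
    show "D \<subseteq> Ob (slice C X)" using p by (auto simp: D_def slice_def)
    show "v \<Zsemi>\<^bsub>slice C X\<^esub> w \<in> W" if "v \<in> W" "w \<in> W" for v w
      using that by (auto simp: W_def slice_def p_add)
    show "D \<noteq> {}" by (simp add: D_def)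
    show "R \<subseteq> W"
    proof
      fix w assume "w \<in> R"
      then obtain n where "w = (?p 1, ?p n)" unfolding R_def p1 by blast
      then show "w \<in> W" unfolding W_def by blast
    qed
    show "\<exists>w\<in>R. Cod (slice C X) w = g" if "g \<in> D" for g
      using that by (auto simp: R_def D_def slice_def)
  next
    fix h w t'
    assume w: "w \<in> R" and h: "h \<in> Ar (slice C X)" and t': "t' \<in> Ar (slice C X)"
      and c: "Cod (slice C X) h = Dom (slice C X) w" "Cod (slice C X) w = Dom (slice C X) t'"
        "Cod (slice C X) t' = Dom (slice C X) h"
      and eq: "h \<Zsemi>\<^bsub>slice C X\<^esub> (w \<Zsemi>\<^bsub>slice C X\<^esub> t') = Idt (slice C X) (Dom (slice C X) h)"
    obtain n where n: "w = (f, ?p n)" using w by (auto simp: R_def)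
    obtain s g where sg: "h = (s, g)" by force
    obtain t k where tk: "t' = (t, k)" by force
    have s: "s \<in> Ar C" "g \<in> Ar C" "Cod C s = Dom C g" using h by (auto simp: sg slice_def)
    have t: "t \<in> Ar C" "k \<in> Ar C" "Cod C t = Dom C k" "Cod C k = X" using t' by (auto simp: tk slice_def)
    \<comment> \<open>In the slice, \<open>t\<close> goes from \<open>f^n\<close> to
      \<open>k\<close> and \<open>s\<close> from \<open>k\<close> to \<open>f^(n+1)\<close>.
      Matching domains and codomains therefore records the commuting triangles over
      \<open>X\<close>.\<close>
    have e: "g = f \<Zsemi> ?p n" "?p n = t \<Zsemi> k" "k = s \<Zsemi> g" "s \<Zsemi> (f \<Zsemi> t) = Idt C (Dom C k)"
      using c eq by (auto simp: n sg tk slice_def)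
    have "Cod C s = X" using s(3) e(1) Dom_Comp[of f "?p n"] f p by simp
    moreover have "Dom C t = X" using Dom_Comp[of t k] t p[of n] e(2) by simp
    moreover have "Dom C s = Dom C k" using Dom_Comp[of s g] s e(3) by simp
    ultimately show thesis using that[OF t(1) _ t(3,2,4) s(1) _ _ e(2)[symmetric] e(4)] by blast
  qed
qed

text \<open>Both remaining clauses rest on the relations \<open>s f t = 1\<close> and
  \<open>t k = f^n\<close>. An idempotent splits through the domain of \<open>k\<close>. For a
  general \<open>f\<close> the candidate idempotent is \<open>f t s\<close>; if it is the identity,
  the Artinian condition supplies a left inverse.\<close>

lemma stably_universally_rigid_imp_SUR3:
  assumes sur: "stably_universally_rigid C" shows "SUR3 C"
  unfolding SUR3_def
proof (intro conjI ballI)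
  have ur: "universally_rigid (slice C X)" if "X \<in> Ob C" for X
    using sur that by (simp add: stably_universally_rigid_def)
  show art: "slices_artinian C"
    unfolding slices_artinian_def
    using category.universally_rigid_imp_artinian[OF category_slice ur] by blast
  show "cauchy_complete C"
    unfolding cauchy_complete_def
  proof (intro ballI impI)
    fix e assume e: "e \<in> Ar C" and ee: "Dom C e = Cod C e \<and> e \<Zsemi> e = e"
    define X where "X = Dom C e"
    have X: "X \<in> Ob C" "Dom C e = X" "Cod C e = X" using e ee Dom_in[OF e] by (auto simp: X_def)
    obtain n t k s where t: "t \<in> Ar C" "Dom C t = X" "Cod C t = Dom C k"
      and k: "k \<in> Ar C" "Cod C k = X" and s: "s \<in> Ar C" "Dom C s = Dom C k" "Cod C s = X"
      and tk: "t \<Zsemi> k = e [^]\<^bsub>End_monoid C X\<^esub> (n::nat)" and set: "s \<Zsemi> (e \<Zsemi> t) = Idt C (Dom C k)"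
      using universally_rigid_slice_endo[OF X(1) ur[OF X(1)] e X(2,3)] by metis
    \<comment> \<open>Multiplying by \<open>e\<close> makes the unknown exponent irrelevant,
      including \<open>n = 0\<close>, where the power is the identity.\<close>
    have "e [^]\<^bsub>End_monoid C X\<^esub> n \<Zsemi> e = e"
    proof (induction n)
      case 0
      show ?case using Idt_Comp[OF e] X by (simp add: End_monoid_def)
    next
      case (Suc n)
      then show ?case using ee by (simp add: End_monoid_def)
    qed
    then have tke: "t \<Zsemi> (k \<Zsemi> e) = e" using tk Comp_assoc[of t k e] t k e X by simp
    \<comment> \<open>Inserting \<open>s e t = 1\<close> in front turns \<open>k e\<close> into
      \<open>s e\<close>, and then \<open>(k e) (e t)\<close> collapses to \<open>s e t\<close>. So
      \<open>e t\<close> and \<open>k e\<close> split \<open>e\<close>.\<close>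
    have "k \<Zsemi> e = (s \<Zsemi> (e \<Zsemi> t)) \<Zsemi> (k \<Zsemi> e)"
      using set Idt_Comp[of "k \<Zsemi> e"] k e X by (simp add: Comp_in Dom_Comp)
    also have "\<dots> = s \<Zsemi> (e \<Zsemi> (t \<Zsemi> (k \<Zsemi> e)))"
      using s t k e X by (simp add: Comp_in Dom_Comp Cod_Comp Comp_assoc)
    finally have ke: "k \<Zsemi> e = s \<Zsemi> e" using tke ee by simp
    have 1: "(e \<Zsemi> t) \<Zsemi> (k \<Zsemi> e) = e"
      using t k e X tke ee by (simp add: Comp_in Dom_Comp Cod_Comp Comp_assoc)
    have "(k \<Zsemi> e) \<Zsemi> (e \<Zsemi> t) = s \<Zsemi> ((e \<Zsemi> e) \<Zsemi> t)"
      unfolding ke using s t k e X by (simp add: Comp_in Dom_Comp Cod_Comp Comp_assoc)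
    then have 2: "(k \<Zsemi> e) \<Zsemi> (e \<Zsemi> t) = Idt C (Dom C k)" using ee set by simp
    show "\<exists>r\<in>Ar C. \<exists>s\<in>Ar C. Dom C r = Dom C e \<and> Cod C r = Dom C s \<and> Cod C s = Dom C e \<and>
           r \<Zsemi> s = e \<and> s \<Zsemi> r = Idt C (Cod C r)"
      using 1 2 t k e X
      by (intro bexI[of _ "e \<Zsemi> t"] bexI[of _ "k \<Zsemi> e"]) (auto simp: Comp_in Dom_Comp Cod_Comp)
  qed
  fix X assume X: "X \<in> Ob C"
  interpret M: monoid "End_monoid C X" by (rule monoid_End[OF X])
  let ?p = "\<lambda>f n::nat. f [^]\<^bsub>End_monoid C X\<^esub> n"
  show "enough_idempotents_left (End_monoid C X)"
    unfolding enough_idempotents_left_def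
  proof
    fix f assume fM: "f \<in> carrier (End_monoid C X)"
    then have f: "f \<in> Ar C" "Dom C f = X" "Cod C f = X" by (auto simp: End_monoid_def)
    obtain n t k s where t: "t \<in> Ar C" "Dom C t = X" "Cod C t = Dom C k"
      and k: "k \<in> Ar C" "Cod C k = X" and s: "s \<in> Ar C" "Dom C s = Dom C k" "Cod C s = X"
      and tk: "t \<Zsemi> k = ?p f n" and sft: "s \<Zsemi> (f \<Zsemi> t) = Idt C (Dom C k)"
      using universally_rigid_slice_endo[OF X ur[OF X] f] by metis
    have pA: "?p f m \<in> Ar C" "Dom C (?p f m) = X" "Cod C (?p f m) = X" for m
      using M.nat_pow_closed[OF fM, of m] by (auto simp: End_monoid_def)
    have pS: "?p f (Suc m) = f \<Zsemi> ?p f m" for m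
      using M.nat_pow_Suc2[OF fM, of m] by (simp add: End_monoid_def)
    let ?g = "t \<Zsemi> s"
    have gA: "?g \<in> Ar C" "Dom C ?g = X" "Cod C ?g = X"
      using t s k by (auto simp: Comp_in Dom_Comp Cod_Comp)
    have sf: "s \<Zsemi> (f \<Zsemi> (t \<Zsemi> u)) = u" if "u \<in> Ar C" "Dom C u = Dom C k" for u
    proof -
      have "s \<Zsemi> (f \<Zsemi> (t \<Zsemi> u)) = (s \<Zsemi> (f \<Zsemi> t)) \<Zsemi> u"
        using that s t f by (simp add: Comp_in Dom_Comp Cod_Comp Comp_assoc)
      then show ?thesis using sft Idt_Comp[of u] that by simp
    qed
    \<comment> \<open>The relation \<open>s f t = 1\<close> makes \<open>f t s\<close> idempotent,
      and it fixes \<open>f^(n+1) = f t k\<close> on the left. The extra factor \<open>f\<close>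
      also makes the exponent positive.\<close>
    let ?e = "f \<Zsemi> ?g"
    have eA: "?e \<in> carrier (End_monoid C X)"
      using f gA by (auto simp: End_monoid_def Comp_in Dom_Comp Cod_Comp)
    show "(\<exists>g\<in>carrier (End_monoid C X). g \<otimes>\<^bsub>End_monoid C X\<^esub> f = \<one>\<^bsub>End_monoid C X\<^esub>) \<or>
      (\<exists>e\<in>carrier (End_monoid C X). e \<noteq> \<one>\<^bsub>End_monoid C X\<^esub> \<and> e \<otimes>\<^bsub>End_monoid C X\<^esub> e = e \<and>
        (\<exists>n. n \<ge> 1 \<and> e \<otimes>\<^bsub>End_monoid C X\<^esub> ?p f n = ?p f n))"
    proof (cases "?e = Idt C X")
      case False
      have "?e \<Zsemi> ?e = f \<Zsemi> (t \<Zsemi> (s \<Zsemi> (f \<Zsemi> (t \<Zsemi> s))))"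
        using f t s k by (simp add: Comp_in Dom_Comp Cod_Comp Comp_assoc)
      then have "?e \<Zsemi> ?e = ?e" using sf[OF s(1,2)] by simp
      moreover have "?e \<Zsemi> ?p f (Suc n) = f \<Zsemi> (t \<Zsemi> (s \<Zsemi> (f \<Zsemi> (t \<Zsemi> k))))"
        unfolding pS tk[symmetric] using f t s k by (simp add: Comp_in Dom_Comp Cod_Comp Comp_assoc)
      then have "?e \<Zsemi> ?p f (Suc n) = ?p f (Suc n)" using sf[OF k(1)] tk pS by simp
      ultimately show ?thesis
        using False eA by (intro disjI2 bexI[of _ ?e]) (auto simp: End_monoid_def intro!: exI[of _ "Suc n"])
    next
      case True
      \<comment> \<open>Now \<open>?g\<close> is a right inverse of \<open>f\<close>, so powers of
        \<open>f\<close> cancel on the right.\<close>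
      have cancel: "a = b" if "a \<Zsemi> ?p f m = b \<Zsemi> ?p f m"
        "a \<in> Ar C" "b \<in> Ar C" "Cod C a = X" "Cod C b = X" for a b m
        using that
      proof (induction m arbitrary: a b)
        case 0
        then show ?case using Comp_Idt[of a] Comp_Idt[of b] by (simp add: End_monoid_def)
      next
        case (Suc m)
        have "(a \<Zsemi> f) \<Zsemi> ?p f m = (b \<Zsemi> f) \<Zsemi> ?p f m"
          using Suc.prems(1)[unfolded pS] Suc.prems(2-) f pA[of m] by (simp add: Comp_assoc)
        then have "a \<Zsemi> f = b \<Zsemi> f" by (rule Suc.IH) (use Suc.prems(2-) f in \<open>simp_all add: Comp_in Cod_Comp\<close>)
        then have "a \<Zsemi> ?e = b \<Zsemi> ?e"
          using Suc.prems f gA Comp_assoc[of a f ?g] Comp_assoc[of b f ?g] by simp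
        then show ?case using True Suc.prems Comp_Idt[of a] Comp_Idt[of b] by simp
      qed
      \<comment> \<open>The descending images of the powers stabilize somewhere, giving
        \<open>f^m = x f^(m+1) = (x f) f^m\<close>; cancelling \<open>f^m\<close> shows that
        \<open>x\<close> is a left inverse.\<close>
      obtain m where "\<not> im C (?p f (Suc m)) \<subset> im C (?p f m)"
        using art[unfolded slices_artinian_iff] X pA unfolding max_sieve_def by blast
      moreover have "im C (?p f (Suc m)) \<subseteq> im C (?p f m)"
        unfolding pS by (rule im_Comp_subset) (use f pA in auto)
      ultimately have "im C (?p f m) \<subseteq> im C (?p f (Suc m))" by blast
      then obtain x where x: "x \<in> Ar C" "Dom C x = X" "Cod C x = X" "?p f m = x \<Zsemi> ?p f (Suc m)"
        using im_subset_iff[OF pA(1) pA(1), of m "Suc m"] unfolding pA by blast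
      then have "Idt C X \<Zsemi> ?p f m = (x \<Zsemi> f) \<Zsemi> ?p f m"
        using Idt_Comp[OF pA(1)[of m]] Comp_assoc[of x f "?p f m"] f pA[of m] pS[of m] by metis
      then have "Idt C X = x \<Zsemi> f"
        by (rule cancel) (use X x f in \<open>auto simp: Idt_in Cod_Idt Comp_in Cod_Comp\<close>)
      then show ?thesis using x by (intro disjI1 bexI[of _ x]) (auto simp: End_monoid_def)
    qed
  qed
qed


section \<open>From enough idempotents to minimal representatives\<close>

text \<open>Minimality of the retract implies that only the identity idempotent fixes
  \<open>s f\<close> on the left. Enough idempotents then upgrades this: every endomorphism fixing
  \<open>s f\<close> on the left is a split epimorphism.\<close>

lemma SUR3_imp_SUR1:
  assumes "SUR3 C" shows "SUR1 C"
  unfolding SUR1_def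
proof (intro conjI ballI)
  have cc: "cauchy_complete C" and en: "\<And>X. X \<in> Ob C \<Longrightarrow> enough_idempotents_left (End_monoid C X)"
    using assms by (auto simp: SUR3_def)
  show art: "slices_artinian C" using assms by (simp add: SUR3_def)
  fix f assume f: "f \<in> Ar C"
  let ?Y = "Dom C f"
  have Y: "?Y \<in> Ob C" by (rule Dom_in[OF f])
  define Q where "Q = {e \<in> Ar C. Dom C e = ?Y \<and> Cod C e = ?Y \<and> e \<Zsemi> e = e \<and> im C (e \<Zsemi> f) = im C f}"
  have "Idt C ?Y \<in> Q"
    using Y f Idt_Comp[OF f] Comp_Idt[of "Idt C ?Y"] by (simp add: Q_def Idt_in Dom_Idt Cod_Idt)
  moreover have "Q \<subseteq> max_sieve C ?Y" by (auto simp: Q_def max_sieve_def)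
  ultimately obtain e where eQ: "e \<in> Q" and min: "\<And>d. d \<in> Q \<Longrightarrow> im C d \<subseteq> im C e \<Longrightarrow> im C d = im C e"
    using slices_artinian_minimal[OF art Y, of Q] by metis
  have e: "e \<in> Ar C" "Dom C e = ?Y" "Cod C e = ?Y" "e \<Zsemi> e = e" "im C (e \<Zsemi> f) = im C f"
    using eQ by (auto simp: Q_def)
  obtain r s where rs: "r \<in> Ar C" "s \<in> Ar C" "Dom C r = ?Y" "Cod C r = Dom C s" "Cod C s = ?Y"
    "r \<Zsemi> s = e" and sr: "s \<Zsemi> r = Idt C (Dom C s)"
    using cc e unfolding cauchy_complete_def by metis
  let ?f = "s \<Zsemi> f"
  have r_epi: "split_epi C r" using rs sr by (auto simp: split_epi_def)
  have fA: "?f \<in> Ar C" "Dom C ?f = Dom C s" "Cod C ?f = Cod C f"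
    using rs f by (auto simp: Comp_in Dom_Comp Cod_Comp)
  have rf: "r \<Zsemi> ?f = e \<Zsemi> f" using rs f Comp_assoc[of r s f] by simp
  have im_f: "im C f = im C ?f" using im_split_epi_Comp[OF r_epi fA(1)] rs fA rf e by simp
  \<comment> \<open>Transporting \<open>d\<close> along the retraction gives \<open>r d s\<close> in
    \<open>Q\<close>, with image inside that of \<open>e\<close>. Minimality writes \<open>e\<close>
    as \<open>x (r d s)\<close>, so \<open>s x r\<close> is a left inverse of \<open>d\<close>, and
    an idempotent with a left inverse is the identity.\<close>
  have idem: "d = Idt C (Dom C s)"
    if d: "d \<in> Ar C" "Dom C d = Dom C s" "Cod C d = Dom C s" "d \<Zsemi> d = d" "d \<Zsemi> ?f = ?f" for d
  proof -
    let ?d = "r \<Zsemi> (d \<Zsemi> s)"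
    have s_r: "s \<Zsemi> (r \<Zsemi> u) = u" if "u \<in> Ar C" "Dom C u = Dom C s" for u
      using that rs Comp_assoc[of s r u] sr Idt_Comp[of u] by simp
    have dA: "?d \<in> Ar C" "Dom C ?d = ?Y" "Cod C ?d = ?Y"
      using d rs by (auto simp: Comp_in Dom_Comp Cod_Comp)
    have "?d \<Zsemi> ?d = r \<Zsemi> (d \<Zsemi> (s \<Zsemi> (r \<Zsemi> (d \<Zsemi> s))))"
      using d rs by (simp add: Comp_in Dom_Comp Cod_Comp Comp_assoc)
    also have "\<dots> = r \<Zsemi> (d \<Zsemi> (d \<Zsemi> s))" using d rs by (simp add: s_r Comp_in Dom_Comp)
    finally have "?d \<Zsemi> ?d = ?d" using d rs Comp_assoc[of d d s] by simp
    moreover have "?d \<Zsemi> f = r \<Zsemi> (d \<Zsemi> ?f)"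
      using d rs f by (simp add: Comp_in Dom_Comp Cod_Comp Comp_assoc)
    then have "?d \<Zsemi> f = e \<Zsemi> f" using d rf by simp
    ultimately have "?d \<in> Q" using dA e by (simp add: Q_def)
    moreover have "?d \<Zsemi> e = r \<Zsemi> (d \<Zsemi> (s \<Zsemi> (r \<Zsemi> s)))"
      unfolding rs(6)[symmetric] using d rs(1-5) by (simp add: Comp_in Dom_Comp Cod_Comp Comp_assoc)
    then have "?d \<Zsemi> e = ?d" using rs(1-5) by (simp add: s_r)
    then have "im C ?d \<subseteq> im C e" using im_Comp_subset[OF dA(1) e(1)] dA e by simp
    ultimately have "im C e \<subseteq> im C ?d" using min by blast
    then obtain x where x: "x \<in> Ar C" "Dom C x = ?Y" "Cod C x = ?Y" "e = x \<Zsemi> ?d"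
      using im_subset_iff[OF e(1) dA(1)] e dA by auto
    let ?x = "s \<Zsemi> (x \<Zsemi> r)"
    have xA: "?x \<in> Ar C" "Cod C ?x = Dom C s" using x rs by (auto simp: Comp_in Dom_Comp Cod_Comp)
    have "?x \<Zsemi> d = s \<Zsemi> ((x \<Zsemi> ?d) \<Zsemi> r)"
      using d x(1-3) rs(1-5) sr Comp_Idt[OF d(1)] by (simp add: Comp_in Dom_Comp Cod_Comp Comp_assoc)
    also have "\<dots> = (s \<Zsemi> r) \<Zsemi> (s \<Zsemi> r)"
      unfolding x(4)[symmetric] rs(6)[symmetric]
      using rs(1-5) by (simp add: Comp_in Dom_Comp Cod_Comp Comp_assoc)
    also have "\<dots> = Idt C (Dom C s)"
      unfolding sr using Comp_Idt[of "Idt C (Dom C s)"] rs by (simp add: Idt_in Cod_Idt Dom_in)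
    finally have xd: "?x \<Zsemi> d = Idt C (Dom C s)" .
    have "d = (?x \<Zsemi> d) \<Zsemi> d" unfolding xd using d Idt_Comp[OF d(1)] by simp
    also have "\<dots> = ?x \<Zsemi> d" using Comp_assoc[of ?x d d] xA d by simp
    finally show ?thesis using xd by simp
  qed
  show "\<exists>f'\<in>Ar C. Cod C f' = Cod C f \<and> im C f = im C f' \<and>
        (\<forall>r\<in>Ar C. Cod C r = Dom C f' \<and> im C f' = im C (r \<Zsemi> f') \<longrightarrow> im C r = max_sieve C (Dom C f'))"
  proof (intro bexI[of _ ?f] conjI ballI impI)
    fix u assume u: "u \<in> Ar C" and "Cod C u = Dom C ?f \<and> im C ?f = im C (u \<Zsemi> ?f)"
    then have u': "Cod C u = Dom C s" and "im C ?f \<subseteq> im C (u \<Zsemi> ?f)" using fA by auto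
    then obtain v where v: "v \<in> Ar C" "Dom C v = Dom C s" "Cod C v = Dom C u" "?f = v \<Zsemi> (u \<Zsemi> ?f)"
      using im_subset_iff[OF fA(1), of "u \<Zsemi> ?f"] fA u by (auto simp: Comp_in Dom_Comp Cod_Comp)
    \<comment> \<open>Since \<open>v u\<close> fixes \<open>s f\<close> on the left, it is enough
      that \<open>v u\<close> is a split epimorphism: then so is \<open>u\<close>.\<close>
    let ?p = "v \<Zsemi> u"
    let ?M = "End_monoid C (Dom C s)"
    have sO: "Dom C s \<in> Ob C" by (rule Dom_in[OF rs(2)])
    interpret M: monoid ?M by (rule monoid_End[OF sO])
    have pM: "?p \<in> carrier ?M" using u u' v by (simp add: End_monoid_def Comp_in Dom_Comp Cod_Comp)
    have pf: "?p \<Zsemi> ?f = ?f" using v u u' fA Comp_assoc[of v u ?f] by simp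
    have pnA: "?p [^]\<^bsub>?M\<^esub> (n::nat) \<in> Ar C" "Dom C (?p [^]\<^bsub>?M\<^esub> n) = Dom C s" "Cod C (?p [^]\<^bsub>?M\<^esub> n) = Dom C s" for n
      using M.nat_pow_closed[OF pM, of n] by (auto simp: End_monoid_def)
    have pnf: "?p [^]\<^bsub>?M\<^esub> (n::nat) \<Zsemi> ?f = ?f" for n
    proof (induction n)
      case 0
      show ?case using Idt_Comp[OF fA(1)] fA by (simp add: End_monoid_def)
    next
      case (Suc n)
      have "?p [^]\<^bsub>?M\<^esub> (Suc n) = ?p [^]\<^bsub>?M\<^esub> n \<Zsemi> ?p" by (simp add: End_monoid_def)
      then show ?case
        using Suc pf Comp_assoc[of "?p [^]\<^bsub>?M\<^esub> n" ?p ?f] pnA[of n] pM fA by (simp add: End_monoid_def)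
    qed
    \<comment> \<open>An idempotent fixing a power of \<open>?p\<close> also fixes
      \<open>?f\<close>, because that power does. This excludes the second alternative of enough
      idempotents.\<close>
    have "d = Idt C (Dom C s)" if d: "d \<in> carrier ?M" "d \<Zsemi> d = d" "d \<Zsemi> ?p [^]\<^bsub>?M\<^esub> n = ?p [^]\<^bsub>?M\<^esub> n" for d and n :: nat
    proof (rule idem)
      show "d \<in> Ar C" "Dom C d = Dom C s" "Cod C d = Dom C s" "d \<Zsemi> d = d"
        using d by (auto simp: End_monoid_def)
      then show "d \<Zsemi> ?f = ?f" using Comp_assoc[of d "?p [^]\<^bsub>?M\<^esub> n" ?f] pnA[of n] pnf[of n] d(3) fA by simp
    qed
    then obtain g where "g \<in> carrier ?M" "g \<otimes>\<^bsub>?M\<^esub> ?p = \<one>\<^bsub>?M\<^esub>"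
      using en[OF sO] pM unfolding enough_idempotents_left_def by (auto simp: End_monoid_def)
    then have "split_epi C ?p"
      using pM by (auto simp: split_epi_def End_monoid_def)
    then have "split_epi C u" using split_epi_left_factor[of v u] u v by simp
    then show "im C u = max_sieve C (Dom C ?f)" using split_epi_iff_im[OF u] u' fA by simp
  qed (use fA im_f in auto)
qed


section \<open>The game of split epi\<close>

lemma cleaner_moveD:
  assumes "cleaner_move C f f'" shows "f' \<in> Ar C" "Cod C f' = Cod C f" "im C f' = im C f"
proof -
  obtain r where r: "f' \<in> Ar C" "split_epi C r" "Cod C r = Dom C f'" "f = r \<Zsemi> f'"
    using assms by (auto simp: cleaner_move_def)
  then show "f' \<in> Ar C" "Cod C f' = Cod C f" "im C f' = im C f"
    using im_split_epi_Comp[of r f'] by (auto simp: split_epi_def Cod_Comp)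
qed

lemma reducer_moveD:
  assumes "reducer_move C f f'" "f \<in> Ar C" shows "f' \<in> Ar C" "Cod C f' = Cod C f"
  using assms by (auto simp: reducer_move_def Comp_in Cod_Comp)

text \<open>Cleaner always moves to a representative as in SUR1. From there every move of Reducer
  strictly shrinks the image, while Cleaner preserves it, so an infinite play would give an infinite
  descent of images.\<close>

lemma SUR1_imp_SUR2:
  assumes "SUR1 C" shows "SUR2 C"
  unfolding SUR2_def
proof (intro ballI allI)
  fix f0 c assume f0: "f0 \<in> Ar C"
  define clean where "clean f f' \<longleftrightarrow> f' \<in> Ar C \<and> Cod C f' = Cod C f \<and> im C f = im C f' \<and>
    (\<forall>r\<in>Ar C. Cod C r = Dom C f' \<and> im C f' = im C (r \<Zsemi> f') \<longrightarrow> split_epi C r)" for f f'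
  have "\<exists>f'. clean f f'" if "f \<in> Ar C" for f
    using assms that unfolding SUR1_def clean_def by (metis split_epi_iff_im)
  then obtain \<kappa> where \<kappa>: "\<And>f. f \<in> Ar C \<Longrightarrow> clean f (\<kappa> f)" by metis
  \<comment> \<open>Equality of images yields \<open>r\<close> with
    \<open>f = r (\<kappa> f)\<close>, and the defining property of \<open>\<kappa> f\<close> forces
    this \<open>r\<close> to be a split epimorphism.\<close>
  have move: "cleaner_move C f (\<kappa> f)" if f: "f \<in> Ar C" for f
  proof -
    have c: "\<kappa> f \<in> Ar C" "Cod C (\<kappa> f) = Cod C f" "im C f = im C (\<kappa> f)"
      "\<And>r. \<lbrakk>r \<in> Ar C; Cod C r = Dom C (\<kappa> f); im C (\<kappa> f) = im C (r \<Zsemi> \<kappa> f)\<rbrakk> \<Longrightarrow> split_epi C r"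
      using \<kappa>[OF f] by (auto simp: clean_def)
    obtain r where r: "r \<in> Ar C" "Cod C r = Dom C (\<kappa> f)" "f = r \<Zsemi> \<kappa> f"
      using im_subset_iff[OF f c(1)] c by auto
    then show ?thesis using c unfolding cleaner_move_def by metis
  qed
  let ?\<sigma> = "\<lambda>h. \<kappa> (last h)"
  have "cleaner_strategy C ?\<sigma>"
    unfolding cleaner_strategy_def using move last_in_set by blast
  moreover have "\<not> (\<exists>p. infinite_play C ?\<sigma> c f0 p)"
  proof
    assume "\<exists>p. infinite_play C ?\<sigma> c f0 p"
    then obtain p where p: "p 0 = f0"
      "\<And>n. if even n \<longleftrightarrow> c then p (Suc n) = \<kappa> (p n) else reducer_move C (p n) (p (Suc n))"
      by (auto simp: infinite_play_def)
    have pA: "p n \<in> Ar C \<and> Cod C (p n) = Cod C f0" for n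
    proof (induction n)
      case 0
      then show ?case using p f0 by simp
    next
      case (Suc n)
      then show ?case
        using p(2)[of n] cleaner_moveD[OF move[of "p n"]] reducer_moveD[of "p n" "p (Suc n)"]
        by (auto split: if_splits)
    qed
    \<comment> \<open>The \<open>n\<close>-th move of Cleaner is made at position
      \<open>i n\<close>, with an offset of one if Reducer starts; \<open>q n\<close> is the
      position just after that move.\<close>
    define i where "i n = 2 * n + (if c then 0 else 1)" for n :: nat
    have ev: "even (i n) \<longleftrightarrow> c" "\<not> (even (Suc (i n)) \<longleftrightarrow> c)" "i (Suc n) = Suc (Suc (i n))" for n
      by (auto simp: i_def)
    define q where "q n = p (Suc (i n))" for n
    have "q n \<in> max_sieve C (Cod C f0) \<and> im C (q (Suc n)) \<subset> im C (q n)" for n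
    proof
      show "q n \<in> max_sieve C (Cod C f0)" using pA by (simp add: q_def max_sieve_def)
      have q: "q n = \<kappa> (p (i n))" "q (Suc n) = \<kappa> (p (i (Suc n)))"
        using p(2)[of "i n"] p(2)[of "i (Suc n)"] ev(1)[of n] ev(1)[of "Suc n"] by (simp_all add: q_def)
      have "reducer_move C (q n) (p (i (Suc n)))"
        using p(2)[of "Suc (i n)"] ev(2)[of n] by (simp add: q_def ev(3))
      then obtain r where r: "r \<in> Ar C" "\<not> split_epi C r" "Cod C r = Dom C (q n)" "p (i (Suc n)) = r \<Zsemi> q n"
        by (auto simp: reducer_move_def)
      have "im C (q (Suc n)) = im C (r \<Zsemi> q n)"
        using cleaner_moveD(3)[OF move, of "p (i (Suc n))"] pA[of "i (Suc n)"] q(2) r(4) by simp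
      moreover have "im C (r \<Zsemi> q n) \<subseteq> im C (q n)"
        by (rule im_Comp_subset) (use r pA in \<open>auto simp: q_def\<close>)
      moreover have "im C (q n) \<noteq> im C (r \<Zsemi> q n)"
        using \<kappa>[of "p (i n)"] pA r unfolding q(1) clean_def by blast
      ultimately show "im C (q (Suc n)) \<subset> im C (q n)" by blast
    qed
    moreover have "slices_artinian C" using assms by (simp add: SUR1_def)
    ultimately show False using Cod_in[OF f0] unfolding slices_artinian_iff by blast
  qed
  ultimately show "\<exists>\<sigma>. cleaner_strategy C \<sigma> \<and> \<not> (\<exists>p. infinite_play C \<sigma> c f0 p)" by blast
qed

text \<open>The survival principle for Reducer: a property of positions that Cleaner cannot destroy
  and Reducer can always maintain defeats every strategy of Cleaner.\<close>

lemma invariant_infinite_play: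
  assumes \<sigma>: "cleaner_strategy C \<sigma>" and f0: "f0 \<in> Ar C" "B f0"
    and cl: "\<And>f f'. \<lbrakk>f \<in> Ar C; B f; cleaner_move C f f'\<rbrakk> \<Longrightarrow> B f'"
    and re: "\<And>f. \<lbrakk>f \<in> Ar C; B f\<rbrakk> \<Longrightarrow> \<exists>f'. reducer_move C f f' \<and> B f'"
  shows "\<exists>p. infinite_play C \<sigma> c f0 p"
proof -
  obtain \<rho> where \<rho>: "\<And>f. \<lbrakk>f \<in> Ar C; B f\<rbrakk> \<Longrightarrow> reducer_move C f (\<rho> f) \<and> B (\<rho> f)"
    using re by metis
  \<comment> \<open>The recursion builds whole histories because \<open>\<sigma>\<close> depends on
    them; the play itself consists of their last entries.\<close>
  define H where "H = rec_nat [f0] (\<lambda>n h. h @ [if even n \<longleftrightarrow> c then \<sigma> h else \<rho> (last h)])"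
  have H: "H 0 = [f0]" "H (Suc n) = H n @ [if even n \<longleftrightarrow> c then \<sigma> (H n) else \<rho> (last (H n))]" for n
    by (simp_all add: H_def)
  define p where "p n = last (H n)" for n
  have Hp: "H n = map p [0..<Suc n]" for n
    by (induction n) (simp_all add: H p_def)
  have inv: "set (H n) \<subseteq> Ar C \<and> B (p n)" for n
  proof (induction n)
    case 0
    then show ?case using f0 by (simp add: H p_def)
  next
    case (Suc n)
    have ne: "H n \<noteq> []" by (simp add: Hp)
    then have pn: "p n \<in> Ar C" "B (p n)" using Suc last_in_set[OF ne] by (auto simp: p_def)
    have "cleaner_move C (p n) (\<sigma> (H n))" using \<sigma> Suc ne unfolding cleaner_strategy_def p_def by blast
    then have "\<sigma> (H n) \<in> Ar C" "B (\<sigma> (H n))" using cleaner_moveD cl[OF pn] by auto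
    moreover have "\<rho> (p n) \<in> Ar C" "B (\<rho> (p n))" using \<rho>[OF pn] reducer_moveD[OF _ pn(1)] by auto
    ultimately show ?case using Suc by (simp add: H p_def)
  qed
  have "infinite_play C \<sigma> c f0 p"
    unfolding infinite_play_def
  proof (intro conjI allI)
    show "p 0 = f0" by (simp add: p_def H)
    fix n
    have "p n \<in> Ar C" using inv[of n] unfolding Hp by auto
    then have "reducer_move C (p n) (\<rho> (p n))" using \<rho> inv by blast
    then show "if even n \<longleftrightarrow> c then p (Suc n) = \<sigma> (map p [0..<Suc n]) else reducer_move C (p n) (p (Suc n))"
      unfolding Hp[symmetric] by (simp add: p_def H)
  qed
  then show ?thesis by blast
qed

text \<open>If \<open>g\<close> is not covered by the sieve \<open>?G\<close> generated by irreducible objects, then Reducer survives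
  in the game starting from the identity of the domain of \<open>g\<close> by keeping the pullback of \<open>?G\<close> along
  the current position noncovering.\<close>

lemma SUR2_imp_stably_universally_rigid:
  assumes sur2: "SUR2 C" shows "stably_universally_rigid C"
  unfolding stably_universally_rigid_def universally_rigid_def
proof (intro ballI allI impI)
  fix X J assume X: "X \<in> Ob C" and J: "grothendieck_topology (slice C X) J"
  let ?S = "slice C X"
  interpret S: category ?S by (rule category_slice[OF X])
  have ArS: "(h, g) \<in> Ar ?S \<longleftrightarrow> h \<in> Ar C \<and> g \<in> Ar C \<and> Cod C h = Dom C g \<and> Cod C g = X" for h g
    by (simp add: slice_def)
  have DS: "Dom ?S (h, g) = h \<Zsemi> g" "Cod ?S (h, g) = g" for h g by (simp_all add: slice_def)
  have CS: "(h, g) \<Zsemi>\<^bsub>?S\<^esub> (h', g') = (h \<Zsemi> h', g')" for h g h' g' by (simp add: slice_def)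
  have ObS: "g \<in> Ob ?S \<longleftrightarrow> g \<in> Ar C \<and> Cod C g = X" for g by (simp add: slice_def)
  let ?I = "{Y. irreducible_obj ?S J Y}"
  show "rigid ?S J"
    unfolding S.rigid_iff_irreducible[OF J]
  proof (intro ballI)
    fix g assume gO: "g \<in> Ob ?S"
    then have g: "g \<in> Ar C" "Cod C g = X" by (auto simp: ObS)
    let ?G = "generated_sieve ?S ?I g"
    have Gs: "sieve ?S g ?G" by (rule S.sieve_generated)
    \<comment> \<open>A position \<open>k\<close> has codomain \<open>Dom C g\<close> and is read as
      the slice arrow \<open>(k, g)\<close> from \<open>k g\<close> to \<open>g\<close>.\<close>
    define B where "B k \<longleftrightarrow> k \<in> Ar C \<and> Cod C k = Dom C g \<and> pull_sieve ?S (k, g) ?G \<notin> J (k \<Zsemi> g)" for k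
    show "?G \<in> J g"
    proof (rule ccontr)
      assume bad: "?G \<notin> J g"
      let ?i = "Idt C (Dom C g)"
      have i: "?i \<in> Ar C" "Cod C ?i = Dom C g" using g by (auto simp: Idt_in Cod_Idt Dom_in)
      have "(?i, g) = Idt ?S g" by (simp add: slice_def)
      then have Bi: "B ?i" using bad S.pull_Idt[OF gO Gs] i Idt_Comp[OF g(1)] by (simp add: B_def)
      \<comment> \<open>If the pullback along \<open>k'\<close> were covering, stability along
        \<open>r\<close> would make the one along \<open>k = r k'\<close> covering.\<close>
      have cl: "B k'" if B: "B k" and mv: "cleaner_move C k k'" for k k'
      proof -
        obtain r where r: "k' \<in> Ar C" "r \<in> Ar C" "Cod C r = Dom C k'" "k = r \<Zsemi> k'"
          using mv by (auto simp: cleaner_move_def split_epi_def)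
        have k': "Cod C k' = Dom C g" using B r by (simp add: B_def Cod_Comp)
        have A: "(k', g) \<in> Ar ?S" "(r, k' \<Zsemi> g) \<in> Ar ?S"
          using r k' g by (auto simp: ArS Comp_in Dom_Comp Cod_Comp)
        have eq: "pull_sieve ?S (r, k' \<Zsemi> g) (pull_sieve ?S (k', g) ?G) = pull_sieve ?S (k, g) ?G"
          using S.pull_pull[OF A] r by (simp add: DS CS)
        have "pull_sieve ?S (k', g) ?G \<notin> J (k' \<Zsemi> g)"
        proof
          assume "pull_sieve ?S (k', g) ?G \<in> J (k' \<Zsemi> g)"
          then have "pull_sieve ?S (k, g) ?G \<in> J (r \<Zsemi> (k' \<Zsemi> g))"
            using S.topology_pull[OF J A(2), of "pull_sieve ?S (k', g) ?G"] eq by (simp add: DS)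
          then show False using B r k' g by (simp add: B_def Comp_assoc)
        qed
        then show ?thesis using r k' by (simp add: B_def)
      qed
      have re: "\<exists>k'. reducer_move C k k' \<and> B k'" if B: "B k" for k
      proof -
        have k: "k \<in> Ar C" "Cod C k = Dom C g" and nc: "pull_sieve ?S (k, g) ?G \<notin> J (k \<Zsemi> g)"
          using B by (auto simp: B_def)
        have kA: "(k, g) \<in> Ar ?S" using k g by (simp add: ArS)
        have kgO: "k \<Zsemi> g \<in> Ob ?S" using k g by (simp add: ObS Comp_in Cod_Comp)
        have sv: "sieve ?S (k \<Zsemi> g) (pull_sieve ?S (k, g) ?G)"
          using S.sieve_pull[OF _ kA] Gs by (simp add: DS)
        \<comment> \<open>An irreducible \<open>k g\<close> would put \<open>(k, g)\<close> into
          \<open>?G\<close>, making the pullback maximal. So there is a proper cover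
          \<open>T\<close>, and transitivity finds a member of \<open>T\<close> along which the
          pullback is still not covering.\<close>
        have "\<not> irreducible_obj ?S J (k \<Zsemi> g)"
        proof
          assume "irreducible_obj ?S J (k \<Zsemi> g)"
          then have "(k, g) \<in> ?G" using kA by (intro S.generated_base) (auto simp: max_sieve_def DS)
          then have "pull_sieve ?S (k, g) ?G = max_sieve ?S (k \<Zsemi> g)"
            using S.pull_eq_max[OF _ Gs] by (simp add: DS)
          then show False using nc S.topology_max[OF J kgO] by simp
        qed
        then obtain T where T: "T \<in> J (k \<Zsemi> g)" "T \<noteq> max_sieve ?S (k \<Zsemi> g)"
          using kgO by (auto simp: irreducible_obj_def)
        have Ts: "sieve ?S (k \<Zsemi> g) T" by (rule S.topology_sieve[OF J kgO T(1)])
        obtain t where t: "t \<in> T" "pull_sieve ?S t (pull_sieve ?S (k, g) ?G) \<notin> J (Dom ?S t)"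
          using S.topology_trans[OF J kgO T(1) sv] nc by blast
        have "t \<in> max_sieve ?S (k \<Zsemi> g)" using t Ts by (auto simp: sieve_def)
        then obtain r where rt: "t = (r, k \<Zsemi> g)" and rA: "t \<in> Ar ?S"
          by (cases t) (auto simp: max_sieve_def DS)
        have r: "r \<in> Ar C" "Cod C r = Dom C k" using rA rt k g by (auto simp: ArS Dom_Comp)
        \<comment> \<open>This makes Reducer's move legal: a section of \<open>r\<close> would put
          the identity into \<open>T\<close>, which is not maximal.\<close>
        have "\<not> split_epi C r"
        proof
          assume "split_epi C r"
          then obtain s where s: "s \<in> Ar C" "Dom C s = Cod C r" "Cod C s = Dom C r" "s \<Zsemi> r = Idt C (Cod C r)"
            by (auto simp: split_epi_def)
          have "(s, r \<Zsemi> (k \<Zsemi> g)) \<in> Ar ?S"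
            using s r k g by (auto simp: ArS Comp_in Dom_Comp Cod_Comp)
          then have "(s, r \<Zsemi> (k \<Zsemi> g)) \<Zsemi>\<^bsub>?S\<^esub> t \<in> T"
            using Ts t(1) unfolding sieve_def by (auto simp: rt DS)
          moreover have "(s, r \<Zsemi> (k \<Zsemi> g)) \<Zsemi>\<^bsub>?S\<^esub> t = Idt ?S (k \<Zsemi> g)"
            using s r k g by (simp add: rt slice_def Dom_Comp)
          ultimately have "Idt ?S (k \<Zsemi> g) \<in> T" by simp
          then have "pull_sieve ?S (Idt ?S (k \<Zsemi> g)) T = max_sieve ?S (k \<Zsemi> g)"
            using S.pull_eq_max[OF _ Ts] S.Dom_Idt[OF kgO] by simp
          then show False using T(2) S.pull_Idt[OF kgO Ts] by simp
        qed
        then have "reducer_move C k (r \<Zsemi> k)" using r by (auto simp: reducer_move_def)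
        moreover have "pull_sieve ?S (r \<Zsemi> k, g) ?G \<notin> J ((r \<Zsemi> k) \<Zsemi> g)"
          using t(2) S.pull_pull[OF kA rA] r k g by (simp add: rt DS CS Comp_assoc)
        then have "B (r \<Zsemi> k)" using r k by (simp add: B_def Comp_in Cod_Comp)
        ultimately show ?thesis by blast
      qed
      obtain \<sigma> where \<sigma>: "cleaner_strategy C \<sigma>" "\<not> (\<exists>p. infinite_play C \<sigma> True ?i p)"
        using sur2 i unfolding SUR2_def by blast
      then show False using invariant_infinite_play[OF \<sigma>(1) i(1), of B True] Bi cl re by blast
    qed
  qed
qed

end

theorem mainTheorem1:
  fixes C :: "('o, 'a) cat"
  assumes "category C"
  shows "(stably_universally_rigid C \<longleftrightarrow> SUR1 C) \<and>
         (stably_universally_rigid C \<longleftrightarrow> SUR2 C) \<and>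
         (stably_universally_rigid C \<longleftrightarrow> SUR3 C)"
proof -
  interpret category C by (rule assms)
  show ?thesis
    using SUR1_imp_SUR2 SUR2_imp_stably_universally_rigid stably_universally_rigid_imp_SUR3 SUR3_imp_SUR1
    by blast
qed

end
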